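(* Let $f\in S^\infty(Q,\mathbb{R})$ and $w\in S^\infty(Q,(0,\infty))$. Then there exist dyadic grids $G_n$ on $Q$ and $G_n$-constant functions $f_n:Q\to\mathbb{R}$ and $w_n:Q\to(0,\infty)$ ($n\in\mathbb{N}$) such that $f_n\to f$ and $w_n\to w$ with respect to $\|\cdot\|_\infty$, and $$p_\sigma^{w_n}(f_n)\longrightarrow p_\sigma^w(f)\quad\text{with respect to }\|\cdot\|_\infty\qquad(n\to\infty).$$ In particular, $S_\sigma(Q,\mathbb{R})$ is dense with respect to $\|\cdot\|_\infty$ in $S^\infty_\sigma(Q,\mathbb{R})$. Additionally, in the special case where $w$ itself is dyadically grid-constant, one has $$\|p_\sigma^w(f_n)-p_\sigma^w(f)\|_\infty\le\|f_n-f\|_\infty.$$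
   Context: Let $Q=[a_1,b_1]\times\dots\times[a_d,b_d]\subset\mathbb{R}^d$ with $a_i<b_i$, and $\sigma\in\{-1,0,1\}^d$. For $x,y\in\mathbb{R}^d$ write $x\le_\sigma y$ iff $\sigma_ix_i\le\sigma_iy_i$ for all $i$ with $\sigma_i=\pm1$ and $x_i=y_i$ for all $i$ with $\sigma_i=0$. For $X\subset\mathbb{R}^d$, a function $f:X\to\mathbb{R}$ is $\sigma$-monotonic iff $x\le_\sigma y$ implies $f(x)\le f(y)$ for all $x,y\in X$. $L^2_\sigma(Q,\mathbb{R})$ is the set of $f\in L^2(Q,\mathbb{R})$ (Lebesgue measure) such that some (equivalently every) representative $f_0$ of $f$ is $\sigma$-monotonic on $Q\setminus N$ for some null set $N$. For a measurable $w$ on $Q$ bounded (a.e.) above and below by positive constants and $f\in L^2(Q,\mathbb{R})$, $p_\sigma^w(f)$ denotes the unique minimizer of $g\mapsto\int_Q|f(x)-g(x)|^2w(x)\,dx$ over $g\in L^2_\sigma(Q,\mathbb{R})$. $\|\cdot\|_\infty$ is the essential supremum norm on $Q$ with Lebesgue measure. Grids: given partitions $a_i=t_{i0}<t_{i1}<\dots<t_{im_i}=b_i$ of $[a_i,b_i]$ for $i=1,\dots,d$, the associated grid on $Q$ is $G=G_1\times\dots\times G_d$ with $G_i=\{(t_{i,k-1}+t_{ik})/2:k=1,\dots,m_i\}$. It is dyadic iff there is an $n\in\mathbb{N}$ (independent of $i$) such that $m_i=2^n$ and $t_{ik}-t_{i,k-1}=(b_i-a_i)/2^n$ for all $i$ and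 $k\in\{1,\dots,2^n\}$. A cell of $G$ is a set $I_1\times\dots\times I_d$ where each $I_i$ is either $[t_{i,k-1},t_{ik})$ for some $k\in\{1,\dots,m_i-1\}$ or $[t_{i,m_i-1},t_{im_i}]$. A function on $Q$ is $G$-constant iff it is constant on each cell of $G$; an equivalence class of functions is $G$-constant iff it has a $G$-constant representative. A function or class is dyadically grid-constant iff it is $G$-constant for some dyadic grid $G$ on $Q$. $S(Q,I)$ is the set of dyadically grid-constant functions on $Q$ with values in $I\subset\mathbb{R}$; $S_\sigma(Q,I)$ is the set of $\sigma$-monotonic $f\in S(Q,I)$. With closures taken in $L^\infty(Q,\mathbb{R})$, $S^\infty(Q,\mathbb{R}):=\overline{S(Q,\mathbb{R})}^{\|\cdot\|_\infty}$ and $S^\infty(Q,(0,\infty)):=\bigcup_{c\in(0,\infty)}\overline{S(Q,[c,\infty))}^{\|\cdot\|_\infty}$. Every $w\in S^\infty(Q,(0,\infty))$ is a.e. bounded above and below by positive constants. $S^\infty_\sigma(Q,\mathbb{R}):=\{f\in S^\infty(Q,\mathbb{R}): f\text{ is }\sigma\text{-monotonic}\}$, where an element of $L^\infty$ is regarded as $\sigma$-monotonic if it has a $\sigma$-monotonic representative. *)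

theory Defs
  imports "HOL-Analysis.Analysis" "HOL-Probability.Essential_Supremum"
begin

text \<open>
  Throughout, the box \<open>Q\<close> is \<^term>\<open>cbox a b\<close> with \<open>a $ i < b $ i\<close> for all \<open>i\<close>.
  Functions on \<open>Q\<close> are total functions on the whole space whose values outside \<open>Q\<close> are irrelevant,
  and elements of \<open>L\<^sup>2(Q)\<close> and \<open>L\<^sup>\<infinity>(Q)\<close> are given by arbitrary representatives: all notions below
  that concern classes are invariant under \<open>ae_eq_on Q\<close>.
\<close>

definition ae_eq_on :: "(real ^ 'd) set \<Rightarrow> (real ^ 'd \<Rightarrow> real) \<Rightarrow> (real ^ 'd \<Rightarrow> real) \<Rightarrow> bool" where
  "ae_eq_on Q f g \<longleftrightarrow> (AE x in lebesgue_on Q. f x = g x)"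

definition L2_space :: "(real ^ 'd) set \<Rightarrow> (real ^ 'd \<Rightarrow> real) set" where
  "L2_space Q = {f \<in> borel_measurable (lebesgue_on Q). integrable (lebesgue_on Q) (\<lambda>x. (f x)\<^sup>2)}"

text \<open>The norm takes values in the extended reals; it is \<open>\<infinity>\<close> for functions that are not
  measurable or not essentially bounded on \<open>Q\<close>.\<close>

definition Linf_norm :: "(real ^ 'd) set \<Rightarrow> (real ^ 'd \<Rightarrow> real) \<Rightarrow> ereal" where
  "Linf_norm Q f = esssup (lebesgue_on Q) (\<lambda>x. ereal \<bar>f x\<bar>)"

definition Linf_space :: "(real ^ 'd) set \<Rightarrow> (real ^ 'd \<Rightarrow> real) set" where
  "Linf_space Q = {f \<in> borel_measurable (lebesgue_on Q). Linf_norm Q f < \<infinity>}"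

definition Linf_closure :: "(real ^ 'd) set \<Rightarrow> (real ^ 'd \<Rightarrow> real) set \<Rightarrow> (real ^ 'd \<Rightarrow> real) set" where
  "Linf_closure Q A =
     {f \<in> Linf_space Q. \<forall>\<epsilon>>0::real. \<exists>g\<in>A. Linf_norm Q (\<lambda>x. g x - f x) < ereal \<epsilon>}"


section \<open>Monotonicity and the weighted projection\<close>

definition sigma_le :: "int ^ 'd \<Rightarrow> real ^ 'd \<Rightarrow> real ^ 'd \<Rightarrow> bool" where
  "sigma_le \<sigma> x y \<longleftrightarrow>
     (\<forall>i. (\<sigma> $ i \<noteq> 0 \<longrightarrow> real_of_int (\<sigma> $ i) * x $ i \<le> real_of_int (\<sigma> $ i) * y $ i) \<and>
          (\<sigma> $ i = 0 \<longrightarrow> x $ i = y $ i))"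

abbreviation sigma_monotonic_on :: "int ^ 'd \<Rightarrow> (real ^ 'd) set \<Rightarrow> (real ^ 'd \<Rightarrow> real) \<Rightarrow> bool" where
  "sigma_monotonic_on \<sigma> X f \<equiv> monotone_on X (sigma_le \<sigma>) (\<le>) f"

definition L2_sigma :: "int ^ 'd \<Rightarrow> (real ^ 'd) set \<Rightarrow> (real ^ 'd \<Rightarrow> real) set" where
  "L2_sigma \<sigma> Q =
     {f \<in> L2_space Q. \<exists>f0. ae_eq_on Q f0 f \<and>
        (\<exists>N \<in> null_sets lebesgue. sigma_monotonic_on \<sigma> (Q - N) f0)}"

text \<open>The minimizer is unique up to \<open>ae_eq_on Q\<close>; \<open>arg_min_on\<close> selects a representative.\<close>

definition proj_sigma ::
  "int ^ 'd \<Rightarrow> (real ^ 'd) set \<Rightarrow> (real ^ 'd \<Rightarrow> real) \<Rightarrow> (real ^ 'd \<Rightarrow> real) \<Rightarrow> real ^ 'd \<Rightarrow> real" where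
  "proj_sigma \<sigma> Q w f =
     arg_min_on (\<lambda>g. \<integral>x. \<bar>f x - g x\<bar>\<^sup>2 * w x \<partial>lebesgue_on Q) (L2_sigma \<sigma> Q)"


section \<open>Grids\<close>

definition box_partition ::
  "real ^ 'd \<Rightarrow> real ^ 'd \<Rightarrow> ('d \<Rightarrow> nat) \<Rightarrow> ('d \<Rightarrow> nat \<Rightarrow> real) \<Rightarrow> bool" where
  "box_partition a b m t \<longleftrightarrow>
     (\<forall>i. t i 0 = a $ i \<and> t i (m i) = b $ i \<and> (\<forall>k\<in>{1..m i}. t i (k - 1) < t i k))"

definition grid_of :: "('d \<Rightarrow> nat) \<Rightarrow> ('d \<Rightarrow> nat \<Rightarrow> real) \<Rightarrow> (real ^ 'd) set" where
  "grid_of m t = {x. \<forall>i. \<exists>k\<in>{1..m i}. x $ i = (t i (k - 1) + t i k) / 2}"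

definition dyadic_grid :: "real ^ 'd \<Rightarrow> real ^ 'd \<Rightarrow> (real ^ 'd) set \<Rightarrow> bool" where
  "dyadic_grid a b G \<longleftrightarrow>
     (\<exists>m t. box_partition a b m t \<and> G = grid_of m t \<and>
        (\<exists>n. \<forall>i. m i = 2 ^ n \<and>
           (\<forall>k\<in>{1..2 ^ n}. t i k - t i (k - 1) = (b $ i - a $ i) / 2 ^ n)))"

definition cell_side :: "nat \<Rightarrow> (nat \<Rightarrow> real) \<Rightarrow> nat \<Rightarrow> real set" where
  "cell_side m t k = (if k = m then {t (m - 1)..t m} else {t (k - 1)..<t k})"

text \<open>The partition (that is, \<open>m i\<close> and \<open>t i k\<close> for \<open>k \<le> m i\<close>) is determined by \<open>a\<close>, \<open>b\<close>
  and the midpoints, so these are the cells of one single partition.\<close>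

definition grid_cells :: "real ^ 'd \<Rightarrow> real ^ 'd \<Rightarrow> (real ^ 'd) set \<Rightarrow> (real ^ 'd) set set" where
  "grid_cells a b G =
     {C. \<exists>m t k. box_partition a b m t \<and> G = grid_of m t \<and> (\<forall>i. k i \<in> {1..m i}) \<and>
         C = {x. \<forall>i. x $ i \<in> cell_side (m i) (t i) (k i)}}"

definition grid_constant ::
  "real ^ 'd \<Rightarrow> real ^ 'd \<Rightarrow> (real ^ 'd) set \<Rightarrow> (real ^ 'd \<Rightarrow> real) \<Rightarrow> bool" where
  "grid_constant a b G f \<longleftrightarrow> (\<forall>C \<in> grid_cells a b G. f constant_on C)"

definition dyadically_grid_constant :: "real ^ 'd \<Rightarrow> real ^ 'd \<Rightarrow> (real ^ 'd \<Rightarrow> real) \<Rightarrow> bool" where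
  "dyadically_grid_constant a b f \<longleftrightarrow> (\<exists>G. dyadic_grid a b G \<and> grid_constant a b G f)"

text \<open>The notion for the equivalence class represented by \<open>f\<close>.\<close>

definition dyadically_grid_constant_class ::
  "real ^ 'd \<Rightarrow> real ^ 'd \<Rightarrow> (real ^ 'd \<Rightarrow> real) \<Rightarrow> bool" where
  "dyadically_grid_constant_class a b f \<longleftrightarrow>
     (\<exists>f0. ae_eq_on (cbox a b) f0 f \<and> dyadically_grid_constant a b f0)"


section \<open>Dyadic step functions and their uniform closures\<close>

definition S_set :: "real ^ 'd \<Rightarrow> real ^ 'd \<Rightarrow> real set \<Rightarrow> (real ^ 'd \<Rightarrow> real) set" where
  "S_set a b I = {f. dyadically_grid_constant a b f \<and> f ` cbox a b \<subseteq> I}"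

definition S_sigma :: "int ^ 'd \<Rightarrow> real ^ 'd \<Rightarrow> real ^ 'd \<Rightarrow> real set \<Rightarrow> (real ^ 'd \<Rightarrow> real) set" where
  "S_sigma \<sigma> a b I = {f \<in> S_set a b I. sigma_monotonic_on \<sigma> (cbox a b) f}"

definition S_inf :: "real ^ 'd \<Rightarrow> real ^ 'd \<Rightarrow> (real ^ 'd \<Rightarrow> real) set" where
  "S_inf a b = Linf_closure (cbox a b) (S_set a b UNIV)"

definition S_inf_pos :: "real ^ 'd \<Rightarrow> real ^ 'd \<Rightarrow> (real ^ 'd \<Rightarrow> real) set" where
  "S_inf_pos a b = (\<Union>c\<in>{0<..}. Linf_closure (cbox a b) (S_set a b {c..}))"

definition S_inf_sigma :: "int ^ 'd \<Rightarrow> real ^ 'd \<Rightarrow> real ^ 'd \<Rightarrow> (real ^ 'd \<Rightarrow> real) set" where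
  "S_inf_sigma \<sigma> a b =
     {f \<in> S_inf a b. \<exists>f0. ae_eq_on (cbox a b) f0 f \<and> sigma_monotonic_on \<sigma> (cbox a b) f0}"

end

theory Submission
  imports Defs
begin

text \<open>
  The class of monotone functions is a closed convex cone in \<open>L\<^sup>2\<close> that is also a lattice and contains
  the constants. Therefore the projection onto it is a contraction in the supremum norm for every
  weight. A change of the weight can be traded for a change of the function: writing \<open>g\<close> for the projection
  of \<open>f\<close> with weight \<open>w\<close>, \<open>g\<close> is also the projection with weight \<open>w'\<close> of \<open>g + (f - g) * w / w'\<close>. By the
  contraction property, the projections of \<open>f\<close> with weights \<open>w\<close> and \<open>w'\<close> then differ by at most
  \<open>2 * \<parallel>f\<parallel> * \<parallel>1 - w / w'\<parallel>\<close> in the supremum norm. So the convergence holds for arbitrary uniform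
  approximations of \<open>f\<close> and \<open>w\<close>, and grids enter only through common refinements. Density of the
  monotone step functions is obtained by sampling a monotone function once per cell.
\<close>

section \<open>Weighted projection onto a lattice cone\<close>

text \<open>In a bare Hilbert space the projection onto a closed convex cone contracts only the
  Hilbert norm. The supremum norm enters by cutting two minimizers, shifted by a constant, against
  each other: the errors compare pointwise, so the comparison survives multiplication by a positive
  weight and integration. Two obstacles come from the encoding. \<open>proj_sigma\<close> is an
  \<open>arg_min_on\<close>, about which nothing is known until a minimizer exists, so existence has
  to be proved as well. And a grid is a bare set of midpoints, while \<open>grid_cells\<close>
  ranges over all partitions with these midpoints; the partition has to be recovered before cells
  can be handled.\<close>

definition square_integrable :: "'a measure \<Rightarrow> ('a \<Rightarrow> real) set" where
  "square_integrable M = {f \<in> borel_measurable M. integrable M (\<lambda>x. (f x)\<^sup>2)}"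

text \<open>The two bounds make the weighted norm equivalent to the unweighted one, so one space of
  functions serves all weights.\<close>

definition weight_on :: "'a measure \<Rightarrow> ('a \<Rightarrow> real) \<Rightarrow> bool" where
  "weight_on M w \<longleftrightarrow> w \<in> borel_measurable M \<and> (\<exists>c>0. \<exists>C. AE x in M. c \<le> w x \<and> w x \<le> C)"

lemma square_integrable_measurable [measurable_dest]:
  "f \<in> square_integrable M \<Longrightarrow> f \<in> borel_measurable M"
  by (simp add: square_integrable_def)

lemma square_integrableI_bound:
  assumes [measurable]: "f \<in> borel_measurable M"
    and "integrable M h" "AE x in M. (f x)\<^sup>2 \<le> h x"
  shows "f \<in> square_integrable M"
  unfolding square_integrable_def
proof (simp, rule Bochner_Integration.integrable_bound[OF assms(2)])
  show "AE x in M. norm ((f x)\<^sup>2) \<le> norm (h x)"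
    using assms(3) by eventually_elim (auto simp: abs_if)
qed measurable

lemma square_integrable_integrable:
  "f \<in> square_integrable M \<Longrightarrow> integrable M (\<lambda>x. (f x)\<^sup>2)"
  by (simp add: square_integrable_def)

lemma square_integrable_scale:
  "f \<in> square_integrable M \<Longrightarrow> (\<lambda>x. c * f x) \<in> square_integrable M"
  by (auto simp: square_integrable_def power_mult_distrib)

lemma square_integrable_add:
  assumes f: "f \<in> square_integrable M" and g: "g \<in> square_integrable M"
  shows "(\<lambda>x. f x + g x) \<in> square_integrable M"
proof (rule square_integrableI_bound)
  show "(\<lambda>x. f x + g x) \<in> borel_measurable M"
    using f g by (auto simp: square_integrable_def)
  show "integrable M (\<lambda>x. 2 * (f x)\<^sup>2 + 2 * (g x)\<^sup>2)"
    using f g by (auto simp: square_integrable_def)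
  have "(f x + g x)\<^sup>2 \<le> 2 * (f x)\<^sup>2 + 2 * (g x)\<^sup>2" for x
    using sum_squares_bound[of "f x" "g x"] by (simp add: power2_sum)
  then show "AE x in M. (f x + g x)\<^sup>2 \<le> 2 * (f x)\<^sup>2 + 2 * (g x)\<^sup>2"
    by simp
qed

lemma square_integrable_diff:
  assumes "f \<in> square_integrable M" "g \<in> square_integrable M"
  shows "(\<lambda>x. f x - g x) \<in> square_integrable M"
  using square_integrable_add[OF assms(1) square_integrable_scale[OF assms(2), of "-1"]] by simp

text \<open>Meant for the quotient of two weights as the bounded factor.\<close>

lemma square_integrable_bounded_mult:
  assumes f: "f \<in> square_integrable M" and [measurable]: "u \<in> borel_measurable M"
    and B: "AE x in M. \<bar>u x\<bar> \<le> B"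
  shows "(\<lambda>x. f x * u x) \<in> square_integrable M"
proof (rule square_integrableI_bound)
  show "(\<lambda>x. f x * u x) \<in> borel_measurable M"
    using f by measurable
  show "integrable M (\<lambda>x. (f x)\<^sup>2 * B\<^sup>2)"
    using square_integrable_integrable[OF f] by simp
  show "AE x in M. (f x * u x)\<^sup>2 \<le> (f x)\<^sup>2 * B\<^sup>2"
    using B
  proof eventually_elim
    case (elim x)
    then have "(u x)\<^sup>2 \<le> B\<^sup>2"
      by (simp add: abs_le_square_iff[symmetric])
    then show ?case
      by (simp add: power_mult_distrib mult_left_mono)
  qed
qed

lemma square_integrable_prod:
  assumes f: "f \<in> square_integrable M" and g: "g \<in> square_integrable M" and w: "weight_on M w"
  shows "integrable M (\<lambda>x. f x * g x * w x)"
proof -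
  obtain c C where [measurable]: "w \<in> borel_measurable M" and "c > 0"
    and C: "AE x in M. c \<le> w x \<and> w x \<le> C"
    using w by (auto simp: weight_on_def)
  note [measurable] = f g
  show ?thesis
  proof (rule Bochner_Integration.integrable_bound)
    show "integrable M (\<lambda>x. ((f x)\<^sup>2 + (g x)\<^sup>2) * C)"
      using f g by (auto simp: square_integrable_def)
    show "(\<lambda>x. f x * g x * w x) \<in> borel_measurable M"
      by measurable
    show "AE x in M. norm (f x * g x * w x) \<le> norm (((f x)\<^sup>2 + (g x)\<^sup>2) * C)"
      using C
    proof eventually_elim
      case (elim x)
      have "\<bar>f x * g x\<bar> \<le> (f x)\<^sup>2 + (g x)\<^sup>2"
        using sum_squares_bound[of "f x" "g x"] sum_squares_bound[of "- f x" "g x"]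
        by (auto simp: abs_if)
      then have "\<bar>f x * g x\<bar> * \<bar>w x\<bar> \<le> ((f x)\<^sup>2 + (g x)\<^sup>2) * C"
        using elim \<open>c > 0\<close> by (intro mult_mono) auto
      then show ?case
        using abs_ge_self[of "((f x)\<^sup>2 + (g x)\<^sup>2) * C"] by (simp add: abs_mult mult.assoc)
    qed
  qed
qed

definition weighted_error ::
  "'a measure \<Rightarrow> ('a \<Rightarrow> real) \<Rightarrow> ('a \<Rightarrow> real) \<Rightarrow> ('a \<Rightarrow> real) \<Rightarrow> real" where
  "weighted_error M w f g = (\<integral>x. \<bar>f x - g x\<bar>\<^sup>2 * w x \<partial>M)"

lemma weighted_error_integrable:
  assumes "f \<in> square_integrable M" "g \<in> square_integrable M" "weight_on M w"
  shows "integrable M (\<lambda>x. \<bar>f x - g x\<bar>\<^sup>2 * w x)"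
proof -
  have "(\<lambda>x. f x - g x) \<in> square_integrable M"
    using assms square_integrable_diff by blast
  from square_integrable_prod[OF this this assms(3)] show ?thesis
    by (simp add: power2_eq_square)
qed

lemma weighted_error_nonneg:
  assumes "weight_on M w"
  shows "0 \<le> weighted_error M w f g"
proof -
  obtain c C where "c > 0" "AE x in M. c \<le> w x \<and> w x \<le> C"
    using assms by (auto simp: weight_on_def)
  then have "AE x in M. 0 \<le> \<bar>f x - g x\<bar>\<^sup>2 * w x"
    by auto
  then show ?thesis
    unfolding weighted_error_def by (rule integral_nonneg_AE)
qed

text \<open>The positive lower bound of the weight turns a vanishing weighted integral into equality
  almost everywhere.\<close>

lemma weighted_error_eq_0D:
  assumes "f \<in> square_integrable M" "g \<in> square_integrable M" "weight_on M w"
    and "weighted_error M w f g \<le> 0"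
  shows "AE x in M. f x = g x"
proof -
  obtain c C where c: "c > 0" "AE x in M. c \<le> w x \<and> w x \<le> C"
    using assms by (auto simp: weight_on_def)
  then have nn: "AE x in M. 0 \<le> \<bar>f x - g x\<bar>\<^sup>2 * w x"
    by auto
  have "weighted_error M w f g = 0"
    using assms(4) weighted_error_nonneg[OF assms(3)] by (intro antisym)
  then have "AE x in M. \<bar>f x - g x\<bar>\<^sup>2 * w x = 0"
    using integral_nonneg_eq_0_iff_AE[OF weighted_error_integrable[OF assms(1-3)] nn]
    by (simp add: weighted_error_def)
  with c(2) show ?thesis
    by eventually_elim (use c(1) in auto)
qed

text \<open>Expansion of the square of (f - g) + (g - h) in the weighted inner product. The sign of
  the mixed term decides whether \<open>g\<close> is optimal.\<close>

lemma weighted_error_shift: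
  assumes "f \<in> square_integrable M" "g \<in> square_integrable M" "h \<in> square_integrable M"
    "weight_on M w"
  shows "weighted_error M w f h =
    weighted_error M w f g + 2 * (\<integral>x. (f x - g x) * (g x - h x) * w x \<partial>M) + weighted_error M w g h"
proof -
  have 1: "integrable M (\<lambda>x. (f x - g x) * (g x - h x) * w x)"
    using assms by (intro square_integrable_prod square_integrable_diff)
  have "weighted_error M w f h =
      (\<integral>x. \<bar>f x - g x\<bar>\<^sup>2 * w x + 2 * ((f x - g x) * (g x - h x) * w x) + \<bar>g x - h x\<bar>\<^sup>2 * w x \<partial>M)"
    unfolding weighted_error_def
    by (intro Bochner_Integration.integral_cong) (auto simp: power2_eq_square algebra_simps)
  also have "\<dots> = weighted_error M w f g + 2 * (\<integral>x. (f x - g x) * (g x - h x) * w x \<partial>M)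
      + weighted_error M w g h"
    using 1 weighted_error_integrable[OF assms(1,2,4)] weighted_error_integrable[OF assms(2,3,4)]
    unfolding weighted_error_def by (simp del: power2_abs)
  finally show ?thesis .
qed

section \<open>Lattice cones, optimality and stability of the projection\<close>

text \<open>Constants supply the shifts by \<open>d\<close>, and \<open>min\<close> and
  \<open>max\<close> the cutting in the contraction argument. Closedness is phrased through limits
  almost everywhere: monotonicity passes to such limits, and the existence proof produces its
  minimizer as one.\<close>

locale isotonic_cone = finite_measure M for M :: "'a measure" +
  fixes K :: "('a \<Rightarrow> real) set"
  assumes K_square_integrable: "g \<in> K \<Longrightarrow> g \<in> square_integrable M"
    and K_const: "(\<lambda>_. c) \<in> K"
    and K_add: "g \<in> K \<Longrightarrow> h \<in> K \<Longrightarrow> (\<lambda>x. g x + h x) \<in> K"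
    and K_scale: "0 \<le> c \<Longrightarrow> g \<in> K \<Longrightarrow> (\<lambda>x. c * g x) \<in> K"
    and K_min: "g \<in> K \<Longrightarrow> h \<in> K \<Longrightarrow> (\<lambda>x. min (g x) (h x)) \<in> K"
    and K_max: "g \<in> K \<Longrightarrow> h \<in> K \<Longrightarrow> (\<lambda>x. max (g x) (h x)) \<in> K"
    and K_AE_limit: "(\<And>n. s n \<in> K) \<Longrightarrow> AE x in M. (\<lambda>n. s n x) \<longlonglongrightarrow> g x \<Longrightarrow>
      g \<in> square_integrable M \<Longrightarrow> g \<in> K"
begin

text \<open>A relation rather than a function, since a minimizer is determined only up to null sets
  and its properties are derived before its existence.\<close>

definition is_proj :: "('a \<Rightarrow> real) \<Rightarrow> ('a \<Rightarrow> real) \<Rightarrow> ('a \<Rightarrow> real) \<Rightarrow> bool" where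
  "is_proj w f g \<longleftrightarrow> g \<in> K \<and> (\<forall>h\<in>K. weighted_error M w f g \<le> weighted_error M w f h)"

lemma K_convex:
  assumes "g \<in> K" "h \<in> K" "0 \<le> t" "t \<le> 1"
  shows "(\<lambda>x. g x + t * (h x - g x)) \<in> K"
proof -
  have "(\<lambda>x. (1 - t) * g x + t * h x) \<in> K"
    using assms by (intro K_add K_scale) auto
  then show ?thesis
    by (simp add: algebra_simps)
qed

text \<open>A step of length t from \<open>g\<close> towards \<open>h\<close> changes the error by t
  * (2 * A + t * B), with \<open>A\<close> the integral and \<open>B\<close> the error between
  \<open>g\<close> and \<open>h\<close>. Minimality makes this nonnegative for all small t, which
  excludes A < 0.\<close>

lemma variational_inequality:
  assumes g: "is_proj w f g" and h: "h \<in> K" and f: "f \<in> square_integrable M" and w: "weight_on M w"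
  shows "0 \<le> (\<integral>x. (f x - g x) * (g x - h x) * w x \<partial>M)"
proof (rule ccontr)
  define A where "A = (\<integral>x. (f x - g x) * (g x - h x) * w x \<partial>M)"
  define B where "B = weighted_error M w g h"
  assume "\<not> ?thesis"
  then have A: "A < 0"
    by (simp add: A_def)
  have gK: "g \<in> K" and B: "B \<ge> 0"
    using g weighted_error_nonneg[OF w] by (auto simp: is_proj_def B_def)
  have key: "0 \<le> 2 * A + t * B" if t: "0 < t" "t \<le> 1" for t
  proof -
    define k where "k = (\<lambda>x. g x + t * (h x - g x))"
    have k: "k \<in> K"
      unfolding k_def using gK h t by (intro K_convex) auto
    have "weighted_error M w f g \<le> weighted_error M w f k"
      using g k by (auto simp: is_proj_def)
    also have "\<dots> = weighted_error M w f g + 2 * (\<integral>x. (f x - g x) * (g x - k x) * w x \<partial>M)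
        + weighted_error M w g k"
      using gK k f w K_square_integrable by (intro weighted_error_shift) auto
    also have "(\<integral>x. (f x - g x) * (g x - k x) * w x \<partial>M) = (\<integral>x. t * ((f x - g x) * (g x - h x) * w x) \<partial>M)"
      by (intro Bochner_Integration.integral_cong) (auto simp: k_def algebra_simps)
    also have "\<dots> = t * A"
      by (simp add: A_def)
    also have "weighted_error M w g k = (\<integral>x. t\<^sup>2 * (\<bar>g x - h x\<bar>\<^sup>2 * w x) \<partial>M)"
      unfolding weighted_error_def
      by (intro Bochner_Integration.integral_cong) (auto simp: k_def algebra_simps power2_eq_square)
    also have "\<dots> = t\<^sup>2 * B"
      by (simp add: B_def weighted_error_def)
    finally have "0 \<le> t * (2 * A + t * B)"
      by (simp add: algebra_simps power2_eq_square)
    then show ?thesis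
      using t by (simp add: zero_le_mult_iff)
  qed
  \<comment> \<open>This choice gives t * B <= - A, so 2 * A + t * B <= A < 0. The summand 1 keeps
    the denominator positive when B = 0.\<close>
  define t where "t = min 1 (- A / (B + 1))"
  have "0 < t" "t \<le> 1" "t \<le> - A / (B + 1)"
    using A B by (auto simp: t_def divide_neg_pos)
  moreover have "t * B \<le> - A"
  proof -
    have "t * (B + 1) \<le> - A"
      using \<open>t \<le> - A / (B + 1)\<close> B by (simp add: field_simps)
    then show ?thesis
      using \<open>0 < t\<close> by (simp add: algebra_simps)
  qed
  ultimately show False
    using key[of t] A by linarith
qed

text \<open>Converse of the variational inequality: in \<open>weighted_error_shift\<close> both
  terms added to the error of \<open>g\<close> are nonnegative.\<close>

lemma is_projI_variational:
  assumes "g \<in> K" "f \<in> square_integrable M" "weight_on M w"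
    and "\<And>h. h \<in> K \<Longrightarrow> 0 \<le> (\<integral>x. (f x - g x) * (g x - h x) * w x \<partial>M)"
  shows "is_proj w f g"
  unfolding is_proj_def
proof (intro conjI ballI)
  fix h assume h: "h \<in> K"
  show "weighted_error M w f g \<le> weighted_error M w f h"
    using weighted_error_shift[of f M g h w] assms h K_square_integrable
      weighted_error_nonneg[OF assms(3), of g h] assms(4)[OF h] by auto
qed (use assms in auto)

text \<open>By the variational inequality the error of \<open>h\<close> exceeds that of the
  minimizer \<open>g\<close> by at least \<open>weighted_error M w g h\<close>. A competitor that is
  no worse therefore has distance zero from \<open>g\<close>.\<close>

lemma is_proj_unique:
  assumes g: "is_proj w f g" and h: "h \<in> K" and f: "f \<in> square_integrable M" and w: "weight_on M w"
    and le: "weighted_error M w f h \<le> weighted_error M w f g"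
  shows "AE x in M. g x = h x"
proof (rule weighted_error_eq_0D[OF _ _ w])
  show sq: "g \<in> square_integrable M" "h \<in> square_integrable M"
    using g h K_square_integrable by (auto simp: is_proj_def)
  show "weighted_error M w g h \<le> 0"
    using weighted_error_shift[OF f sq w] variational_inequality[OF g h f w] le by linarith
qed

text \<open>Replacing the pair \<open>(g', g)\<close> by \<open>(min g' (g + d), max (g' - d) g)\<close> does not increase the sum
  of the two errors, so uniqueness forces \<open>g' \<le> g + d\<close>.\<close>

lemma is_proj_le_add:
  assumes g: "is_proj w f g" and g': "is_proj w f' g'"
    and f: "f \<in> square_integrable M" and f': "f' \<in> square_integrable M" and w: "weight_on M w"
    and le: "AE x in M. f' x \<le> f x + d"
  shows "AE x in M. g' x \<le> g x + d"
proof -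
  have K: "g \<in> K" "g' \<in> K"
    using g g' by (auto simp: is_proj_def)
  define u where "u = (\<lambda>x. min (g' x) (g x + d))"
  define v where "v = (\<lambda>x. max (g' x + - d) (g x))"
  have u: "u \<in> K" and v: "v \<in> K"
    unfolding u_def v_def by (intro K_min K_max K_add K K_const)+
  obtain c C where c: "c > 0" "AE x in M. c \<le> w x \<and> w x \<le> C"
    using w by (auto simp: weight_on_def)
  have int: "integrable M (\<lambda>x. \<bar>f x - g x\<bar>\<^sup>2 * w x)" "integrable M (\<lambda>x. \<bar>f x - v x\<bar>\<^sup>2 * w x)"
    "integrable M (\<lambda>x. \<bar>f' x - g' x\<bar>\<^sup>2 * w x)" "integrable M (\<lambda>x. \<bar>f' x - u x\<bar>\<^sup>2 * w x)"
    using f f' w K u v K_square_integrable by (intro weighted_error_integrable; blast)+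
  have "AE x in M. \<bar>f' x - u x\<bar>\<^sup>2 * w x + \<bar>f x - v x\<bar>\<^sup>2 * w x
      \<le> \<bar>f' x - g' x\<bar>\<^sup>2 * w x + \<bar>f x - g x\<bar>\<^sup>2 * w x"
    using le c(2)
  proof eventually_elim
    case (elim x)
    have "\<bar>f' x - u x\<bar>\<^sup>2 + \<bar>f x - v x\<bar>\<^sup>2 \<le> \<bar>f' x - g' x\<bar>\<^sup>2 + \<bar>f x - g x\<bar>\<^sup>2"
    proof (cases "g' x \<le> g x + d")
      case True
      then show ?thesis
        by (simp add: u_def v_def)
    next
      case False
      \<comment> \<open>Where the cut is active, the sum of the two squares decreases by exactly
        twice this product.\<close>
      have "(f x + d - f' x) * (g' x - (g x + d)) \<ge> 0"
        using False elim(1) by (intro mult_nonneg_nonneg) auto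
      then show ?thesis
        using False by (simp add: u_def v_def power2_eq_square algebra_simps)
    qed
    then show ?case
      using c(1) elim(2) mult_right_mono[of _ _ "w x"] by (fastforce simp: algebra_simps)
  qed
  then have "(\<integral>x. \<bar>f' x - u x\<bar>\<^sup>2 * w x + \<bar>f x - v x\<bar>\<^sup>2 * w x \<partial>M)
      \<le> (\<integral>x. \<bar>f' x - g' x\<bar>\<^sup>2 * w x + \<bar>f x - g x\<bar>\<^sup>2 * w x \<partial>M)"
    using int by (intro integral_mono_AE) auto
  then have "weighted_error M w f' u + weighted_error M w f v
      \<le> weighted_error M w f' g' + weighted_error M w f g"
    using int by (simp add: weighted_error_def)
  \<comment> \<open>Since \<open>v\<close> does not beat \<open>g\<close> as an approximation of
    \<open>f\<close>, it is \<open>u\<close> that must be no worse than \<open>g'\<close> for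
    \<open>f'\<close>.\<close>
  moreover have "weighted_error M w f g \<le> weighted_error M w f v"
    using g v by (auto simp: is_proj_def)
  ultimately have "weighted_error M w f' u \<le> weighted_error M w f' g'"
    by linarith
  from is_proj_unique[OF g' u f' w this] show ?thesis
    by eventually_elim (simp add: u_def)
qed

lemma is_proj_contraction:
  assumes "is_proj w f g" "is_proj w f' g'"
    and "f \<in> square_integrable M" "f' \<in> square_integrable M" "weight_on M w"
    and "AE x in M. \<bar>f' x - f x\<bar> \<le> d"
  shows "AE x in M. \<bar>g' x - g x\<bar> \<le> d"
proof -
  have "AE x in M. g' x \<le> g x + d" "AE x in M. g x \<le> g' x + d"
    using assms by (intro is_proj_le_add[of w f g f' g'] is_proj_le_add[of w f' g' f g]; auto)+
  then show ?thesis
    by eventually_elim auto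
qed

text \<open>Contraction applied to \<open>f\<close> and the zero function, which is its own
  projection.\<close>

lemma is_proj_bound:
  assumes g: "is_proj w f g" and f: "f \<in> square_integrable M" and w: "weight_on M w"
    and B: "AE x in M. \<bar>f x\<bar> \<le> B"
  shows "AE x in M. \<bar>g x\<bar> \<le> B"
proof -
  have z: "(\<lambda>_. 0) \<in> square_integrable M"
    using K_const K_square_integrable by auto
  have "is_proj w (\<lambda>_. 0) (\<lambda>_. 0)"
    using z K_const w by (intro is_projI_variational) auto
  from is_proj_contraction[OF this g z f w] B show ?thesis
    by simp
qed

text \<open>The variational inequality for \<open>w\<close> and \<open>f\<close> involves only the product \<open>(f - g) * w\<close>. Hence \<open>g\<close>
  is also the projection with weight \<open>w'\<close> of \<open>g + (f - g) * (w / w')\<close>.\<close>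

lemma is_proj_change_weight:
  assumes g: "is_proj w f g" and f: "f \<in> square_integrable M"
    and w: "weight_on M w" and w': "weight_on M w'"
  defines "f' \<equiv> (\<lambda>x. g x + (f x - g x) * (w x / w' x))"
  shows "f' \<in> square_integrable M" "is_proj w' f' g"
proof -
  obtain c C where c: "c > 0" "AE x in M. c \<le> w x \<and> w x \<le> C" and [measurable]: "w \<in> borel_measurable M"
    using w by (auto simp: weight_on_def)
  obtain c' C' where c': "c' > 0" "AE x in M. c' \<le> w' x \<and> w' x \<le> C'" and [measurable]: "w' \<in> borel_measurable M"
    using w' by (auto simp: weight_on_def)
  have gK: "g \<in> K"
    using g by (auto simp: is_proj_def)
  have "AE x in M. \<bar>w x / w' x\<bar> \<le> C / c'"
    using c(2) c'(2)
  proof eventually_elim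
    case (elim x)
    then show ?case
      using c(1) c'(1) by (auto intro!: frac_le)
  qed
  then show f': "f' \<in> square_integrable M"
    unfolding f'_def using f gK K_square_integrable
    by (intro square_integrable_add square_integrable_bounded_mult[where B = "C / c'"]
        square_integrable_diff) auto
  show "is_proj w' f' g"
  proof (rule is_projI_variational[OF gK f' w'])
    fix h assume h: "h \<in> K"
    have [measurable]: "f \<in> borel_measurable M" "g \<in> borel_measurable M" "h \<in> borel_measurable M"
      using f gK h K_square_integrable by (auto simp: square_integrable_def)
    have "(\<integral>x. (f' x - g x) * (g x - h x) * w' x \<partial>M) = (\<integral>x. (f x - g x) * (g x - h x) * w x \<partial>M)"
    proof (rule integral_cong_AE)
      show "AE x in M. (f' x - g x) * (g x - h x) * w' x = (f x - g x) * (g x - h x) * w x"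
        using c'(2) by eventually_elim (use c'(1) in \<open>auto simp: f'_def field_simps\<close>)
    qed (simp_all add: f'_def)
    then show "0 \<le> (\<integral>x. (f' x - g x) * (g x - h x) * w' x \<partial>M)"
      using variational_inequality[OF g h f w] by simp
  qed
qed

lemma is_proj_weight_perturbation:
  assumes g: "is_proj w f g" and g': "is_proj w' f g'" and f: "f \<in> square_integrable M"
    and w: "weight_on M w" and w': "weight_on M w'"
    and B: "AE x in M. \<bar>f x\<bar> \<le> B"
    and c: "c > 0" "AE x in M. c \<le> w' x" and e: "AE x in M. \<bar>w' x - w x\<bar> \<le> e"
  shows "AE x in M. \<bar>g' x - g x\<bar> \<le> 2 * B * (e / c)"
proof -
  define f' where "f' = (\<lambda>x. g x + (f x - g x) * (w x / w' x))"
  have f': "f' \<in> square_integrable M" "is_proj w' f' g"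
    unfolding f'_def using is_proj_change_weight[OF g f w w'] .
  have "AE x in M. \<bar>f x - f' x\<bar> \<le> 2 * B * (e / c)"
    using B is_proj_bound[OF g f w B] c(2) e
  proof eventually_elim
    case (elim x)
    \<comment> \<open>The first factor is at most 2 * B, because \<open>is_proj_bound\<close> gives
      \<open>g\<close> the same bound as \<open>f\<close>; the second is the relative change of the
      weight, at most e / c.\<close>
    have "f x - f' x = (f x - g x) * ((w' x - w x) / w' x)"
      using elim c(1) by (auto simp: f'_def field_simps)
    moreover have "\<bar>f x - g x\<bar> * \<bar>(w' x - w x) / w' x\<bar> \<le> (2 * B) * (e / c)"
      using elim c(1) by (intro mult_mono) (auto intro!: frac_le simp: divide_nonneg_pos)
    ultimately show ?case
      by (simp add: abs_mult)
  qed
  from is_proj_contraction[OF f'(2) g' f'(1) f w' this] show ?thesis .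
qed

section \<open>Existence of the projection\<close>

text \<open>The parallelogram identity for f - g and f - h. As the midpoint stays in
  \<open>K\<close> and cannot beat the infimum, two near-minimizers must be close to each
  other.\<close>

lemma weighted_error_midpoint:
  assumes f: "f \<in> square_integrable M" and g: "g \<in> K" and h: "h \<in> K" and w: "weight_on M w"
  shows "weighted_error M w g h = 2 * weighted_error M w f g + 2 * weighted_error M w f h
    - 4 * weighted_error M w f (\<lambda>x. g x + 1/2 * (h x - g x))"
proof -
  let ?m = "\<lambda>x. g x + 1/2 * (h x - g x)"
  have m: "?m \<in> K"
    using g h by (intro K_convex) auto
  have int: "integrable M (\<lambda>x. \<bar>f x - g x\<bar>\<^sup>2 * w x)" "integrable M (\<lambda>x. \<bar>f x - h x\<bar>\<^sup>2 * w x)"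
    "integrable M (\<lambda>x. \<bar>f x - ?m x\<bar>\<^sup>2 * w x)"
    using f w g h m K_square_integrable by (intro weighted_error_integrable; blast)+
  have "weighted_error M w g h = (\<integral>x. 2 * (\<bar>f x - g x\<bar>\<^sup>2 * w x) + 2 * (\<bar>f x - h x\<bar>\<^sup>2 * w x)
      - 4 * (\<bar>f x - ?m x\<bar>\<^sup>2 * w x) \<partial>M)"
    unfolding weighted_error_def
    by (intro Bochner_Integration.integral_cong) (auto simp: power2_eq_square field_simps)
  also have "\<dots> = 2 * weighted_error M w f g + 2 * weighted_error M w f h - 4 * weighted_error M w f ?m"
    using int unfolding weighted_error_def by simp
  finally show ?thesis .
qed

text \<open>A minimizing sequence is Cauchy in L2 by the midpoint identity, hence Cauchy in L1
  because the measure is finite. So a subsequence converges almost everywhere, and Fatou's lemma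
  shows that its limit attains the infimum.\<close>

lemma is_proj_exists:
  assumes f: "f \<in> square_integrable M" and w: "weight_on M w"
  shows "\<exists>g. is_proj w f g"
proof -
  let ?J = "weighted_error M w f"
  define I where "I = (INF g\<in>K. ?J g)"
  obtain c C where c: "c > 0" "AE x in M. c \<le> w x \<and> w x \<le> C" and [measurable]: "w \<in> borel_measurable M"
    using w by (auto simp: weight_on_def)
  have [measurable]: "f \<in> borel_measurable M"
    using f by (simp add: square_integrable_def)
  have bdd: "bdd_below (?J ` K)"
    using weighted_error_nonneg[OF w] by (intro bdd_belowI[where m = 0]) auto
  have ne: "K \<noteq> {}"
    using K_const by auto
  have I_le: "I \<le> ?J g" if "g \<in> K" for g
    unfolding I_def using bdd that by (rule cINF_lower)
  have "\<exists>g\<in>K. ?J g < I + 1 / real (Suc n)" for n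
    using cINF_less_iff[OF ne bdd, of "I + 1 / real (Suc n)"] unfolding I_def by auto
  then obtain s where sK: "\<And>n. s n \<in> K" and s: "\<And>n. ?J (s n) < I + 1 / real (Suc n)"
    by metis
  have sq: "s n \<in> square_integrable M" for n
    using sK K_square_integrable by auto
  have [measurable]: "s n \<in> borel_measurable M" for n
    using sq by (simp add: square_integrable_def)
  have intd: "integrable M (\<lambda>x. (s i x - s j x)\<^sup>2)" for i j
    using square_integrable_integrable[OF square_integrable_diff[OF sq sq]] .
  have ints: "integrable M (s n)" for n
  proof (rule Bochner_Integration.integrable_bound)
    show "integrable M (\<lambda>x. 1 + (s n x)\<^sup>2)"
      using square_integrable_integrable[OF sq] by auto
    have "\<bar>t\<bar> \<le> 1 + t\<^sup>2" for t :: real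
      using sum_squares_bound[of 1 "\<bar>t\<bar>"] by simp
    then show "AE x in M. norm (s n x) \<le> norm (1 + (s n x)\<^sup>2)"
      by simp
  qed simp
  \<comment> \<open>In the midpoint identity the multiples of \<open>I\<close> cancel, which leaves
    twice the excess of each error over \<open>I\<close>; dividing by \<open>c\<close> removes the
    weight.\<close>
  have d2: "(\<integral>x. (s i x - s j x)\<^sup>2 \<partial>M) \<le> (2 / real (Suc i) + 2 / real (Suc j)) / c" for i j
  proof -
    have "c * (\<integral>x. (s i x - s j x)\<^sup>2 \<partial>M) = (\<integral>x. c * (s i x - s j x)\<^sup>2 \<partial>M)"
      by simp
    also have "\<dots> \<le> (\<integral>x. \<bar>s i x - s j x\<bar>\<^sup>2 * w x \<partial>M)"
    proof (rule integral_mono_AE)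
      show "AE x in M. c * (s i x - s j x)\<^sup>2 \<le> \<bar>s i x - s j x\<bar>\<^sup>2 * w x"
        using c(2) by eventually_elim (simp add: mult_right_mono mult.commute[of _ "w _"])
    qed (use intd weighted_error_integrable[OF sq sq w] in auto)
    also have "\<dots> = weighted_error M w (s i) (s j)"
      by (simp add: weighted_error_def)
    also have "\<dots> \<le> 2 / real (Suc i) + 2 / real (Suc j)"
    proof -
      have m: "(\<lambda>x. s i x + 1/2 * (s j x - s i x)) \<in> K"
        using sK by (intro K_convex) auto
      show ?thesis
        using weighted_error_midpoint[OF f sK sK w, of i j] I_le[OF m] s[of i] s[of j] by linarith
    qed
    finally show ?thesis
      using c(1) by (subst pos_le_divide_eq) (simp_all only: mult.commute)
  qed
  have cauchy: "\<exists>N. \<forall>i\<ge>N. \<forall>j\<ge>N. (\<integral>x. norm (s i x - s j x) \<partial>M) < e" if e: "e > 0" for e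
  proof -
    define \<mu> where "\<mu> = measure M (space M)"
    \<comment> \<open>The L1 distance is split by |t| <= \<eta> + t^2 / \<eta>. The constant part
      integrates to \<eta> * \<mu> < e / 2, and \<open>d2\<close> controls the quadratic part. The
      summand 1 covers \<mu> = 0.\<close>
    define \<eta> where "\<eta> = e / (2 * (\<mu> + 1))"
    have \<mu>: "\<mu> \<ge> 0"
      by (simp add: \<mu>_def)
    have \<eta>: "\<eta> > 0"
      using e \<mu> by (simp add: \<eta>_def)
    have \<eta>\<mu>: "\<eta> * \<mu> < e / 2"
      using e \<mu> by (simp add: \<eta>_def field_simps)
    obtain N where N: "4 / (c * \<eta> * (e / 2)) < real N"
      using reals_Archimedean2 by blast
    have "(\<integral>x. norm (s i x - s j x) \<partial>M) < e" if "i \<ge> N" "j \<ge> N" for i j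
    proof -
      have "(\<integral>x. norm (s i x - s j x) \<partial>M) \<le> (\<integral>x. \<eta> + (s i x - s j x)\<^sup>2 / \<eta> \<partial>M)"
      proof (rule integral_mono)
        fix x
        have "\<bar>t\<bar> \<le> \<eta> + t\<^sup>2 / \<eta>" for t :: real
        proof -
          have "\<bar>t\<bar> * \<eta> \<le> \<eta> * \<eta> + t\<^sup>2"
            using sum_squares_bound[of \<eta> "\<bar>t\<bar>"] mult_nonneg_nonneg[OF less_imp_le[OF \<eta>] abs_ge_zero[of t]]
            by (simp add: algebra_simps power2_eq_square)
          then show ?thesis
            using \<eta> by (simp add: field_simps)
        qed
        then show "norm (s i x - s j x) \<le> \<eta> + (s i x - s j x)\<^sup>2 / \<eta>"
          by simp
      qed (use ints intd in auto)
      also have "\<dots> = \<eta> * \<mu> + (\<integral>x. (s i x - s j x)\<^sup>2 \<partial>M) / \<eta>"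
        using intd by (simp add: \<mu>_def mult.commute)
      also have "(\<integral>x. (s i x - s j x)\<^sup>2 \<partial>M) / \<eta> \<le> (2 / real (Suc i) + 2 / real (Suc j)) / c / \<eta>"
        using d2 \<eta> by (intro divide_right_mono) auto
      also have "\<dots> \<le> (2 / real (Suc N) + 2 / real (Suc N)) / c / \<eta>"
        using that c(1) \<eta> by (intro divide_right_mono add_mono divide_left_mono) auto
      also have "\<dots> < e / 2"
      proof -
        have "4 / (c * \<eta> * (e / 2)) < real (Suc N)"
          using N by simp
        then have "4 < real (Suc N) * (c * \<eta> * (e / 2))"
          using c(1) \<eta> e by (subst (asm) pos_divide_less_eq) auto
        moreover have "(2 / m + 2 / m) / c / \<eta> < e / 2"
          if "0 < m" "4 < m * (c * \<eta> * (e / 2))" for m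
          using c(1) \<eta> that by (simp add: field_simps)
        ultimately show ?thesis
          by (metis of_nat_0_less_iff zero_less_Suc)
      qed
      finally show ?thesis
        using \<eta>\<mu> by simp
    qed
    then show ?thesis
      by blast
  qed
  obtain r where r: "strict_mono r" and "AE x in M. Cauchy (\<lambda>i. s (r i) x)"
    using cauchy_L1_AE_cauchy_subseq[OF ints cauchy] by blast
  \<comment> \<open>Taking \<open>lim\<close> at every point gives measurability at once; the points
    of divergence form a null set.\<close>
  define g where "g = (\<lambda>x. lim (\<lambda>i. s (r i) x))"
  have [measurable]: "g \<in> borel_measurable M"
    unfolding g_def by measurable
  have lim: "AE x in M. (\<lambda>i. s (r i) x) \<longlonglongrightarrow> g x"
    using \<open>AE x in M. Cauchy _\<close>
    by eventually_elim (simp add: g_def Cauchy_convergent_iff convergent_LIMSEQ_iff)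
  \<comment> \<open>Stated for the nonnegative integral, as the error of \<open>g\<close> is not yet
    known to be integrable; its finiteness is obtained from this bound.\<close>
  have fatou: "(\<integral>\<^sup>+x. ennreal (\<bar>f x - g x\<bar>\<^sup>2 * w x) \<partial>M) \<le> ennreal I"
  proof -
    have "(\<integral>\<^sup>+x. ennreal (\<bar>f x - g x\<bar>\<^sup>2 * w x) \<partial>M)
        = (\<integral>\<^sup>+x. liminf (\<lambda>n. ennreal (\<bar>f x - s (r n) x\<bar>\<^sup>2 * w x)) \<partial>M)"
    proof (rule nn_integral_cong_AE)
      show "AE x in M. ennreal (\<bar>f x - g x\<bar>\<^sup>2 * w x) = liminf (\<lambda>n. ennreal (\<bar>f x - s (r n) x\<bar>\<^sup>2 * w x))"
        using lim
      proof eventually_elim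
        case (elim x)
        have "(\<lambda>n. ennreal (\<bar>f x - s (r n) x\<bar>\<^sup>2 * w x)) \<longlonglongrightarrow> ennreal (\<bar>f x - g x\<bar>\<^sup>2 * w x)"
          by (intro tendsto_ennrealI tendsto_intros elim)
        then show ?case
          by (intro lim_imp_Liminf[symmetric]) auto
      qed
    qed
    also have "\<dots> \<le> liminf (\<lambda>n. \<integral>\<^sup>+x. ennreal (\<bar>f x - s (r n) x\<bar>\<^sup>2 * w x) \<partial>M)"
      by (intro nn_integral_liminf) measurable
    also have "\<dots> = liminf (\<lambda>n. ennreal (?J (s (r n))))"
    proof -
      have "(\<integral>\<^sup>+x. ennreal (\<bar>f x - s (r n) x\<bar>\<^sup>2 * w x) \<partial>M) = ennreal (?J (s (r n)))" for n
        unfolding weighted_error_def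
      proof (rule nn_integral_eq_integral)
        show "AE x in M. 0 \<le> \<bar>f x - s (r n) x\<bar>\<^sup>2 * w x"
          using c by auto
      qed (rule weighted_error_integrable[OF f sq w])
      then show ?thesis
        by simp
    qed
    also have "\<dots> = ennreal I"
    proof (rule lim_imp_Liminf)
      have "(\<lambda>n. ?J (s n)) \<longlonglongrightarrow> I"
      proof (rule tendsto_sandwich[of "\<lambda>_. I" _ _ "\<lambda>n. I + 1 / real (Suc n)"])
        show "(\<lambda>n. I + 1 / real (Suc n)) \<longlonglongrightarrow> I"
          using LIMSEQ_inverse_real_of_nat_add[of I] by (simp add: inverse_eq_divide)
        show "\<forall>\<^sub>F n in sequentially. ?J (s n) \<le> I + 1 / real (Suc n)"
          using s by (intro always_eventually) (auto intro: less_imp_le)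
      qed (use I_le sK in auto)
      then show "(\<lambda>n. ennreal (?J (s (r n)))) \<longlonglongrightarrow> ennreal I"
        using LIMSEQ_subseq_LIMSEQ[OF _ r, of "\<lambda>n. ?J (s n)" I] by (intro tendsto_ennrealI) (simp add: o_def)
    qed simp
    finally show ?thesis .
  qed
  have nn: "AE x in M. 0 \<le> \<bar>f x - g x\<bar>\<^sup>2 * w x"
    using c by auto
  have int: "integrable M (\<lambda>x. \<bar>f x - g x\<bar>\<^sup>2 * w x)"
    using fatou nn by (intro integrableI_nonneg) (auto simp: less_top[symmetric] top_unique)
  \<comment> \<open>Dividing the finite weighted error by the lower bound \<open>c\<close> of the
    weight dominates (f - g)^2, and with \<open>f\<close> also \<open>g\<close> is square
    integrable.\<close>
  have "(\<lambda>x. f x - g x) \<in> square_integrable M"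
  proof (rule square_integrableI_bound)
    show "integrable M (\<lambda>x. \<bar>f x - g x\<bar>\<^sup>2 * w x / c)"
      using int by simp
    show "AE x in M. (f x - g x)\<^sup>2 \<le> \<bar>f x - g x\<bar>\<^sup>2 * w x / c"
      using c(2)
    proof eventually_elim
      case (elim x)
      then have "(f x - g x)\<^sup>2 * c \<le> (f x - g x)\<^sup>2 * w x"
        by (intro mult_left_mono) auto
      then show ?case
        using c(1) by (simp add: field_simps)
    qed
  qed simp
  from square_integrable_diff[OF f this] have gsq: "g \<in> square_integrable M"
    by simp
  have gK: "g \<in> K"
    using K_AE_limit[of "\<lambda>i. s (r i)"] sK lim gsq by auto
  have "ennreal (?J g) \<le> ennreal I"
    using fatou nn_integral_eq_integral[OF int nn] by (simp add: weighted_error_def)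
  moreover have "0 \<le> I"
    unfolding I_def using ne weighted_error_nonneg[OF w] by (intro cINF_greatest) auto
  ultimately have "?J g \<le> I"
    by (simp add: ennreal_le_iff)
  with gK I_le show ?thesis
    unfolding is_proj_def by force
qed

end


section \<open>Dyadic grids\<close>

lemma box_partition_strict:
  assumes "box_partition a b m t" "j < k" "k \<le> m i"
  shows "t i j < t i k"
  using assms(2,3)
proof (induction k)
  case (Suc k)
  have "t i k < t i (Suc k)"
    using assms(1) Suc.prems unfolding box_partition_def by (metis Suc_leI atLeastAtMost_iff diff_Suc_1 zero_less_Suc One_nat_def)
  then show ?case
    using Suc by (cases "j = k") auto
qed simp

lemma box_partition_le:
  assumes "box_partition a b m t" "j \<le> k" "k \<le> m i"
  shows "t i j \<le> t i k"
  using box_partition_strict[OF assms(1), of j k i] assms(2,3) by (cases "j = k") auto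

lemma box_partition_pos:
  assumes "box_partition a b m t" "\<forall>i. a $ i < b $ i"
  shows "1 \<le> m i"
proof (rule ccontr)
  assume "\<not> 1 \<le> m i"
  then have "m i = 0" by simp
  then have "a $ i = b $ i"
    using assms(1) unfolding box_partition_def by metis
  with assms(2) show False
    by (metis less_irrefl)
qed

text \<open>A grid is a product set with nonempty factors, so each factor is its coordinate
  projection. A given midpoint is completed to a grid point by the first midpoint in every other
  coordinate.\<close>

lemma grid_of_coordinate:
  assumes part: "box_partition a b m t" and ab: "\<forall>i. a $ i < b $ i"
  shows "(\<lambda>x. x $ i) ` grid_of m t = (\<lambda>k. (t i (k - 1) + t i k) / 2) ` {1..m i}"
proof (intro equalityI subsetI)
  fix c assume "c \<in> (\<lambda>k. (t i (k - 1) + t i k) / 2) ` {1..m i}"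
  then obtain k where k: "k \<in> {1..m i}" "c = (t i (k - 1) + t i k) / 2"
    by blast
  define x where "x = (\<chi> j. if j = i then c else (t j (1 - 1) + t j 1) / 2)"
  have "x \<in> grid_of m t"
    unfolding grid_of_def mem_Collect_eq
  proof
    fix j
    show "\<exists>k\<in>{1..m j}. x $ j = (t j (k - 1) + t j k) / 2"
    proof (cases "j = i")
      case True
      then show ?thesis
        using k by (auto simp: x_def)
    next
      case False
      then show ?thesis
        using box_partition_pos[OF part ab, of j] by (intro bexI[of _ 1]) (auto simp: x_def)
    qed
  qed
  moreover have "x $ i = c"
    by (simp add: x_def)
  ultimately show "c \<in> (\<lambda>x. x $ i) ` grid_of m t"
    by force
next
  fix c assume "c \<in> (\<lambda>x. x $ i) ` grid_of m t"
  then obtain x where "x \<in> grid_of m t" "c = x $ i"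
    by blast
  then show "c \<in> (\<lambda>k. (t i (k - 1) + t i k) / 2) ` {1..m i}"
    unfolding grid_of_def by blast
qed

text \<open>Inductively, the first midpoint beyond \<open>t i k\<close> determines \<open>t i (k + 1)\<close>.\<close>

lemma grid_of_inject:
  fixes a b :: "real ^ 'd"
  assumes ab: "\<forall>i. a $ i < b $ i"
    and p: "box_partition a b m t" and p': "box_partition a b m' t'"
    and eq: "grid_of m t = grid_of m' t'"
  shows "m = m'" and "k \<le> m i \<Longrightarrow> t i k = t' i k"
proof -
  \<comment> \<open>A strictly increasing \<open>t\<close> cannot reach b $ i before its last index,
    so \<open>t'\<close> cannot end at a node shared with \<open>t\<close> at an earlier index of
    \<open>t\<close>.\<close>
  have less: "k < m' i" if p: "box_partition a b m t" and p': "box_partition a b m' t'"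
    and "k < m i" "k \<le> m' i" "t i k = t' i k" for m m' t t' k and i :: 'd
  proof (rule ccontr)
    assume "\<not> k < m' i"
    then have "t' i k = b $ i" and "t i (m i) = b $ i"
      using that by (auto simp: box_partition_def)
    then show False
      using box_partition_strict[OF p, of k "m i" i] that by simp
  qed
  \<comment> \<open>The midpoint of \<open>t\<close> that follows node k is a midpoint of
    \<open>t'\<close> with some index j. It lies beyond the common node, so j > k, and the node sum
    is at least that of the next interval of \<open>t'\<close>. Exchanging the two partitions gives
    equality.\<close>
  have le: "t' i (Suc k) \<le> t i (Suc k)"
    if p: "box_partition a b m t" and p': "box_partition a b m' t'" and eq: "grid_of m t = grid_of m' t'"
    and k: "k < m i" "k < m' i" "t i k = t' i k" for m m' t t' k and i :: 'd
  proof -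
    have "(t i (Suc k - 1) + t i (Suc k)) / 2 \<in> (\<lambda>k. (t' i (k - 1) + t' i k) / 2) ` {1..m' i}"
      unfolding grid_of_coordinate[OF p' ab, symmetric] eq[symmetric] grid_of_coordinate[OF p ab]
      using k by (intro imageI) auto
    then obtain j where j: "1 \<le> j" "j \<le> m' i" "t i k + t i (Suc k) = t' i (j - 1) + t' i j"
      by auto
    have "k < j"
    proof (rule ccontr)
      assume "\<not> k < j"
      then have "t' i (j - 1) \<le> t' i k" "t' i j \<le> t' i k"
        using k by (auto intro!: box_partition_le[OF p'])
      moreover have "t i k < t i (Suc k)"
        using k by (intro box_partition_strict[OF p]) auto
      ultimately show False
        using j k by linarith
    qed
    then have "t' i k \<le> t' i (j - 1)" "t' i (Suc k) \<le> t' i j"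
      using j by (auto intro!: box_partition_le[OF p'])
    then show ?thesis
      using j k by linarith
  qed
  have *: "k \<le> m i \<Longrightarrow> k \<le> m' i \<and> t i k = t' i k"
    if p: "box_partition a b m t" and p': "box_partition a b m' t'" and eq: "grid_of m t = grid_of m' t'"
    for m m' t t' k and i :: 'd
  proof (induction k)
    case 0
    then show ?case
      using p p' by (simp add: box_partition_def)
  next
    case (Suc k)
    then have k: "k < m i" "k \<le> m' i" "t i k = t' i k"
      by auto
    then have k': "k < m' i"
      using less[OF p p'] by blast
    then have "t i (Suc k) = t' i (Suc k)"
      using le[OF p p' eq k(1) k' k(3)] le[OF p' p eq[symmetric] k' k(1) k(3)[symmetric]] by simp
    with k' show ?case
      by simp
  qed
  show "m = m'"
  proof
    fix i
    show "m i = m' i"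
      using *[OF p p' eq, of "m i" i] *[OF p' p eq[symmetric], of "m' i" i] by simp
  qed
  show "k \<le> m i \<Longrightarrow> t i k = t' i k"
    using *[OF p p' eq] by blast
qed

section \<open>Dyadic levels and cell indices\<close>

definition dyadic_node :: "real ^ 'd \<Rightarrow> real ^ 'd \<Rightarrow> nat \<Rightarrow> 'd \<Rightarrow> nat \<Rightarrow> real" where
  "dyadic_node a b n i k = a $ i + real k * ((b $ i - a $ i) / 2 ^ n)"

definition dyadic_level :: "real ^ 'd \<Rightarrow> real ^ 'd \<Rightarrow> nat \<Rightarrow> (real ^ 'd) set" where
  "dyadic_level a b n = grid_of (\<lambda>_. 2 ^ n) (dyadic_node a b n)"

lemma dyadic_node_Suc: "dyadic_node a b n i (Suc k) = dyadic_node a b n i k + (b $ i - a $ i) / 2 ^ n"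
  by (simp add: dyadic_node_def distrib_right add_divide_distrib)

lemma dyadic_node_ends: "dyadic_node a b n i 0 = a $ i" "dyadic_node a b n i (2 ^ n) = b $ i"
  by (simp_all add: dyadic_node_def)

lemma dyadic_node_step:
  "k \<ge> 1 \<Longrightarrow> dyadic_node a b n i k - dyadic_node a b n i (k - 1) = (b $ i - a $ i) / 2 ^ n"
  using dyadic_node_Suc[of a b n i "k - 1"] by simp

lemma box_partition_dyadic:
  assumes "\<forall>i. a $ i < b $ i"
  shows "box_partition a b (\<lambda>_. 2 ^ n) (dyadic_node a b n)"
  unfolding box_partition_def
proof (intro allI conjI ballI)
  fix i k assume "k \<in> {1..(2::nat) ^ n}"
  moreover have "0 < (b $ i - a $ i) / 2 ^ n"
    using assms by simp
  ultimately show "dyadic_node a b n i (k - 1) < dyadic_node a b n i k"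
    using dyadic_node_step[of k a b n i] by simp
qed (simp_all add: dyadic_node_ends)

text \<open>The left end and the constant step width fix all nodes. Dyadic grids thus form a
  sequence indexed by one number, in which any two have a common refinement.\<close>

lemma dyadic_grid_iff:
  assumes ab: "\<forall>i. a $ i < b $ i"
  shows "dyadic_grid a b G \<longleftrightarrow> (\<exists>n. G = dyadic_level a b n)"
proof
  assume "dyadic_grid a b G"
  then obtain m t n where p: "box_partition a b m t" and G: "G = grid_of m t"
    and n: "\<forall>i. m i = 2 ^ n \<and> (\<forall>k\<in>{1..2 ^ n}. t i k - t i (k - 1) = (b $ i - a $ i) / 2 ^ n)"
    unfolding dyadic_grid_def by blast
  have t: "k \<le> 2 ^ n \<Longrightarrow> t i k = dyadic_node a b n i k" for i k
  proof (induction k)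
    case 0
    then show ?case
      using p by (simp add: box_partition_def dyadic_node_def)
  next
    case (Suc k)
    then have "t i (Suc k) - t i (Suc k - 1) = (b $ i - a $ i) / 2 ^ n"
      using n by (metis One_nat_def Suc_le_mono atLeastAtMost_iff le0)
    with Suc show ?case
      by (simp add: dyadic_node_Suc)
  qed
  have "m = (\<lambda>_. 2 ^ n)"
    using n by auto
  moreover have "(t i (k - 1) + t i k) / 2 = (dyadic_node a b n i (k - 1) + dyadic_node a b n i k) / 2"
    if "k \<in> {1..2 ^ n}" for i k
    using that t[of k i] t[of "k - 1" i] by auto
  ultimately have "G = dyadic_level a b n"
    unfolding G dyadic_level_def grid_of_def by (metis (no_types, lifting))
  then show "\<exists>n. G = dyadic_level a b n" ..
next
  assume "\<exists>n. G = dyadic_level a b n"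
  then obtain n where G: "G = dyadic_level a b n" ..
  have "\<forall>i. \<forall>k\<in>{1..2 ^ n}. dyadic_node a b n i k - dyadic_node a b n i (k - 1) = (b $ i - a $ i) / 2 ^ n"
    using dyadic_node_step by (metis atLeastAtMost_iff)
  then show "dyadic_grid a b G"
    using box_partition_dyadic[OF ab, of n] unfolding dyadic_grid_def G dyadic_level_def by blast
qed

text \<open>Counts from 0, whereas \<open>cell_side\<close> counts from 1. The cap 2 ^ n - 1 puts
  the right end of a side into the last cell, which is closed. Being total, it assigns points
  outside the box to boundary cells.\<close>

definition cell_index :: "real ^ 'd \<Rightarrow> real ^ 'd \<Rightarrow> nat \<Rightarrow> real ^ 'd \<Rightarrow> 'd \<Rightarrow> nat" where
  "cell_index a b n x i = min (2 ^ n - 1) (nat \<lfloor>(x $ i - a $ i) / (b $ i - a $ i) * 2 ^ n\<rfloor>)"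

lemma cell_index_less: "cell_index a b n x i < 2 ^ n"
  by (simp add: cell_index_def min_less_iff_disj)

lemma cell_index_mono:
  assumes "a $ i < b $ i" "x $ i \<le> y $ i"
  shows "cell_index a b n x i \<le> cell_index a b n y i"
  unfolding cell_index_def using assms
  by (intro min.mono nat_mono floor_mono mult_right_mono divide_right_mono) auto

text \<open>In the coordinate z, measured from the left end in units of the step width, the nodes
  are the integers and the claim concerns the floor of z. The last cell is separate because it is
  closed and the cap acts there.\<close>

lemma mem_cell_side_iff:
  assumes ab: "a $ i < b $ i" and k: "k \<in> {1..2 ^ n}"
  shows "x $ i \<in> cell_side (2 ^ n) (dyadic_node a b n i) k \<longleftrightarrow>
    a $ i \<le> x $ i \<and> x $ i \<le> b $ i \<and> cell_index a b n x i = k - 1"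
proof -
  define z where "z = (x $ i - a $ i) / (b $ i - a $ i) * 2 ^ n"
  have x: "x $ i = a $ i + z * ((b $ i - a $ i) / 2 ^ n)"
    using ab by (simp add: z_def)
  have h: "(b $ i - a $ i) / 2 ^ n > 0"
    using ab by simp
  have node_le: "dyadic_node a b n i j \<le> x $ i \<longleftrightarrow> real j \<le> z" "x $ i \<le> dyadic_node a b n i j \<longleftrightarrow> z \<le> real j"
    "x $ i < dyadic_node a b n i j \<longleftrightarrow> z < real j" for j
    unfolding x dyadic_node_def using h
    by (simp_all only: add_le_cancel_left add_less_cancel_left mult_le_cancel_right_pos mult_less_cancel_right_pos)
  have le: "a $ i \<le> x $ i \<longleftrightarrow> 0 \<le> z" "x $ i \<le> b $ i \<longleftrightarrow> z \<le> 2 ^ n"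
    using node_le(1)[of 0] node_le(2)[of "2 ^ n"] by (simp_all add: dyadic_node_def)
  have n: "real (2 ^ n - 1) = 2 ^ n - 1"
    by (simp add: of_nat_diff)
  have idx: "cell_index a b n x i = min (2 ^ n - 1) (nat \<lfloor>z\<rfloor>)"
    by (simp add: cell_index_def z_def)
  have nat_floor: "nat \<lfloor>z\<rfloor> = j \<longleftrightarrow> real j \<le> z \<and> z < real j + 1" "j \<le> nat \<lfloor>z\<rfloor> \<longleftrightarrow> real j \<le> z" if "0 \<le> z" for j
    using that by linarith+
  show ?thesis
  proof (cases "k = 2 ^ n")
    case True
    have "x $ i \<in> cell_side (2 ^ n) (dyadic_node a b n i) k \<longleftrightarrow> real (2 ^ n - 1) \<le> z \<and> z \<le> 2 ^ n"
      using True node_le by (auto simp: cell_side_def)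
    also have "\<dots> \<longleftrightarrow> 0 \<le> z \<and> z \<le> 2 ^ n \<and> 2 ^ n - 1 \<le> nat \<lfloor>z\<rfloor>"
      using nat_floor(2)[of "2 ^ n - 1"] of_nat_0_le_iff[of "2 ^ n - 1", where 'a = real] by linarith
    also have "\<dots> \<longleftrightarrow> a $ i \<le> x $ i \<and> x $ i \<le> b $ i \<and> cell_index a b n x i = k - 1"
      unfolding le idx True by (auto simp: min_def)
    finally show ?thesis .
  next
    case False
    then have k': "k - 1 < 2 ^ n - 1" "real (k - 1) + 1 = real k" "real k \<le> 2 ^ n" "k < 2 ^ n"
      using k by (auto simp flip: of_nat_le_iff)
    have "x $ i \<in> cell_side (2 ^ n) (dyadic_node a b n i) k \<longleftrightarrow> real (k - 1) \<le> z \<and> z < real k"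
      using False node_le by (auto simp: cell_side_def)
    also have "\<dots> \<longleftrightarrow> 0 \<le> z \<and> z \<le> 2 ^ n \<and> nat \<lfloor>z\<rfloor> = k - 1"
      using nat_floor(1)[of "k - 1"] k' of_nat_0_le_iff[of "k - 1", where 'a = real] by linarith
    also have "\<dots> \<longleftrightarrow> a $ i \<le> x $ i \<and> x $ i \<le> b $ i \<and> cell_index a b n x i = k - 1"
      unfolding le idx using k'(1) by (auto simp: min_def)
    finally show ?thesis .
  qed
qed

lemma mem_cbox_vec: "x \<in> cbox a b \<longleftrightarrow> (\<forall>i. a $ i \<le> x $ i \<and> x $ i \<le> b $ i)" for x :: "real ^ 'd"
  by (simp add: mem_box_cart)

text \<open>\<open>grid_of_inject\<close> leaves the dyadic partition as the only one with these
  midpoints; the cells then are the fibres of \<open>cell_index\<close> in the box, and partitions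
  disappear from later arguments.\<close>

lemma grid_cells_dyadic_level:
  fixes a b :: "real ^ 'd"
  assumes ab: "\<forall>i. a $ i < b $ i"
  shows "grid_cells a b (dyadic_level a b n) =
    {C. \<exists>k. (\<forall>i. k i < 2 ^ n) \<and> C = {x \<in> cbox a b. cell_index a b n x = k}}" (is "_ = ?R")
proof -
  have cell: "{x. \<forall>i. x $ i \<in> cell_side (2 ^ n) (dyadic_node a b n i) (k i)}
      = {x \<in> cbox a b. cell_index a b n x = (\<lambda>i. k i - 1)}" if "\<forall>i. k i \<in> {1..2 ^ n}" for k :: "'d \<Rightarrow> nat"
    using mem_cell_side_iff[of a _ b] ab that by (auto simp: mem_cbox_vec fun_eq_iff)
  show ?thesis
  proof (intro equalityI subsetI)
    fix C assume "C \<in> grid_cells a b (dyadic_level a b n)"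
    then obtain m t k where p: "box_partition a b m t" and eq: "dyadic_level a b n = grid_of m t"
      and k: "\<forall>i. k i \<in> {1..m i}" and C: "C = {x. \<forall>i. x $ i \<in> cell_side (m i) (t i) (k i)}"
      unfolding grid_cells_def by blast
    note inj = grid_of_inject[OF ab box_partition_dyadic[OF ab] p eq[unfolded dyadic_level_def]]
    have m: "m i = 2 ^ n" for i
      using inj(1) by auto
    have t: "dyadic_node a b n i j = t i j" if "j \<le> 2 ^ n" for i j
      using inj(2) that by auto
    have "cell_side (m i) (t i) (k i) = cell_side (2 ^ n) (dyadic_node a b n i) (k i)" for i
      using k[rule_format, of i] m[of i] unfolding cell_side_def by (auto simp: t)
    then have "C = {x \<in> cbox a b. cell_index a b n x = (\<lambda>i. k i - 1)}"
      using cell[of k] k m unfolding C by simp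
    moreover have "k i - 1 < 2 ^ n" for i
      using k[rule_format, of i] m[of i] by auto
    ultimately show "C \<in> ?R"
      by (intro CollectI exI[of _ "\<lambda>i. k i - 1"]) simp
  next
    fix C assume "C \<in> ?R"
    then obtain k :: "'d \<Rightarrow> nat" where k: "\<forall>i. k i < 2 ^ n" "C = {x \<in> cbox a b. cell_index a b n x = k}"
      by blast
    have "C = {x. \<forall>i. x $ i \<in> cell_side (2 ^ n) (dyadic_node a b n i) (Suc (k i))}"
      using cell[of "\<lambda>i. Suc (k i)"] k by (auto simp: Suc_le_eq)
    then show "C \<in> grid_cells a b (dyadic_level a b n)"
      unfolding grid_cells_def mem_Collect_eq using box_partition_dyadic[OF ab, of n] k(1)
      by (intro exI[of _ "\<lambda>_. 2 ^ n"] exI[of _ "dyadic_node a b n"] exI[of _ "\<lambda>i. Suc (k i)"])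
        (auto simp: dyadic_level_def Suc_le_eq)
  qed
qed

lemma grid_constant_dyadic_level_iff:
  assumes ab: "\<forall>i. a $ i < b $ i"
  shows "grid_constant a b (dyadic_level a b n) f \<longleftrightarrow>
    (\<forall>x\<in>cbox a b. \<forall>y\<in>cbox a b. cell_index a b n x = cell_index a b n y \<longrightarrow> f x = f y)"
proof
  assume L: "grid_constant a b (dyadic_level a b n) f"
  show "\<forall>x\<in>cbox a b. \<forall>y\<in>cbox a b. cell_index a b n x = cell_index a b n y \<longrightarrow> f x = f y"
  proof (intro ballI impI)
    fix x y assume xy: "x \<in> cbox a b" "y \<in> cbox a b" "cell_index a b n x = cell_index a b n y"
    have "{z \<in> cbox a b. cell_index a b n z = cell_index a b n x} \<in> grid_cells a b (dyadic_level a b n)"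
      unfolding grid_cells_dyadic_level[OF ab] using cell_index_less by blast
    with L have "f constant_on {z \<in> cbox a b. cell_index a b n z = cell_index a b n x}"
      unfolding grid_constant_def by blast
    then show "f x = f y"
      using xy unfolding constant_on_def by auto
  qed
next
  assume R: "\<forall>x\<in>cbox a b. \<forall>y\<in>cbox a b. cell_index a b n x = cell_index a b n y \<longrightarrow> f x = f y"
  show "grid_constant a b (dyadic_level a b n) f"
    unfolding grid_constant_def
  proof
    fix C assume "C \<in> grid_cells a b (dyadic_level a b n)"
    then obtain k where C: "C = {x \<in> cbox a b. cell_index a b n x = k}"
      unfolding grid_cells_dyadic_level[OF ab] by blast
    show "f constant_on C"
    proof (cases "C = {}")
      case False
      then obtain y where "y \<in> C"
        by blast
      then show ?thesis
        using R unfolding constant_on_def C by (intro exI[of _ "f y"]) simp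
    qed (simp add: constant_on_def)
  qed
qed

text \<open>Dividing by an integer before taking the floor agrees with integer division after it,
  and the cap is compatible because (2 ^ n' - 1) div q = 2 ^ n - 1.\<close>

lemma cell_index_coarsen:
  assumes "n \<le> n'"
  shows "cell_index a b n x i = cell_index a b n' x i div 2 ^ (n' - n)"
proof -
  define r where "r = (x $ i - a $ i) / (b $ i - a $ i)"
  define q :: nat where "q = 2 ^ (n' - n)"
  have pow: "2 ^ n' = 2 ^ n * q" "(2::real) ^ n' = 2 ^ n * real q"
    using assms by (simp_all add: q_def power_add[symmetric])
  have q: "q > 0"
    by (simp add: q_def)
  have "\<lfloor>r * 2 ^ n\<rfloor> = \<lfloor>r * 2 ^ n' / real q\<rfloor>"
    using q by (simp add: pow)
  also have "\<dots> = \<lfloor>r * 2 ^ n'\<rfloor> div int q"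
    using floor_divide_real_eq_div[of "int q" "r * 2 ^ n'"] by simp
  finally have "nat \<lfloor>r * 2 ^ n\<rfloor> = nat \<lfloor>r * 2 ^ n'\<rfloor> div q"
    by (simp add: nat_div_distrib')
  moreover have "(2 ^ n' - 1) div q = 2 ^ n - 1"
  proof (rule div_nat_eqI)
    show "q * (2 ^ n - 1) \<le> 2 ^ n' - 1"
      using q by (simp add: pow diff_mult_distrib2 mult.commute)
    show "2 ^ n' - 1 < q * Suc (2 ^ n - 1)"
      using q by (simp add: pow mult.commute)
  qed
  moreover have "min u v div q = min (u div q) (v div q)" for u v :: nat
    using min_of_mono[of "\<lambda>k. k div q" u v] by (simp add: mono_def div_le_mono)
  ultimately show ?thesis
    unfolding cell_index_def r_def[symmetric] q_def[symmetric] by simp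
qed

lemma grid_constant_refine:
  assumes ab: "\<forall>i. a $ i < b $ i" and "n \<le> n'" and "grid_constant a b (dyadic_level a b n) f"
  shows "grid_constant a b (dyadic_level a b n') f"
proof -
  have "cell_index a b n x = cell_index a b n y" if "cell_index a b n' x = cell_index a b n' y" for x y
    using that by (simp add: fun_eq_iff cell_index_coarsen[OF assms(2)])
  with assms(3) show ?thesis
    unfolding grid_constant_dyadic_level_iff[OF ab] by blast
qed

section \<open>Cell corners, measurability and sampling\<close>

text \<open>A finite-valued choice of one point per cell, through which every grid-constant function
  factors on the box.\<close>

definition cell_corner :: "real ^ 'd \<Rightarrow> real ^ 'd \<Rightarrow> nat \<Rightarrow> real ^ 'd \<Rightarrow> real ^ 'd" where
  "cell_corner a b n x = (\<chi> i. dyadic_node a b n i (cell_index a b n x i))"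

text \<open>Used twice: with u = 0 the corner represents its cell, and with a generic u it becomes
  the sampling point.\<close>

lemma cell_corner_offset:
  fixes a b :: "real ^ 'd"
  assumes ab: "\<forall>i. a $ i < b $ i" and u: "\<forall>i. 0 \<le> u $ i \<and> u $ i < (b $ i - a $ i) / 2 ^ n"
  shows "cell_corner a b n x + u \<in> cbox a b"
    "cell_index a b n (cell_corner a b n x + u) = cell_index a b n x"
proof -
  have "a $ i \<le> (cell_corner a b n x + u) $ i \<and> (cell_corner a b n x + u) $ i \<le> b $ i \<and>
    cell_index a b n (cell_corner a b n x + u) i = Suc (cell_index a b n x i) - 1" for i
  proof (subst mem_cell_side_iff[symmetric])
    let ?k = "cell_index a b n x i"
    show "a $ i < b $ i"
      using ab by simp
    show "Suc ?k \<in> {1..2 ^ n}"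
      using cell_index_less[of a b n x i] by simp
    have x: "dyadic_node a b n i ?k \<le> (cell_corner a b n x + u) $ i"
      "(cell_corner a b n x + u) $ i < dyadic_node a b n i (Suc ?k)"
      using u[rule_format, of i] by (simp_all add: cell_corner_def dyadic_node_Suc)
    show "(cell_corner a b n x + u) $ i \<in> cell_side (2 ^ n) (dyadic_node a b n i) (Suc ?k)"
    proof (cases "Suc ?k = 2 ^ n")
      case True
      then have "2 ^ n - 1 = ?k"
        by simp
      with x True show ?thesis
        unfolding cell_side_def True by (simp add: less_imp_le)
    next
      case False
      with x show ?thesis
        unfolding cell_side_def by simp
    qed
  qed
  then show "cell_corner a b n x + u \<in> cbox a b"
    "cell_index a b n (cell_corner a b n x + u) = cell_index a b n x"
    unfolding mem_cbox_vec fun_eq_iff diff_Suc_1 by blast+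
qed

lemma finite_range_cell_corner: "finite (range (cell_corner a b n))"
  for a b :: "real ^ 'd"
proof -
  have "range (cell_index a b n) \<subseteq> (UNIV \<rightarrow>\<^sub>E {..<2 ^ n})"
    using cell_index_less by (intro image_subsetI PiE_I) simp_all
  then have "finite (range (cell_index a b n))"
    by (rule finite_subset) (simp add: finite_PiE)
  moreover have "range (cell_corner a b n) = (\<lambda>k. \<chi> i. dyadic_node a b n i (k i)) ` range (cell_index a b n)"
    by (auto simp: cell_corner_def image_image)
  ultimately show ?thesis
    by simp
qed

lemma grid_constant_cell_corner:
  fixes a b :: "real ^ 'd"
  assumes ab: "\<forall>i. a $ i < b $ i" and "grid_constant a b (dyadic_level a b n) f" "x \<in> cbox a b"
  shows "f x = f (cell_corner a b n x)"
proof -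
  have 0: "\<forall>i. 0 \<le> (0::real ^ 'd) $ i \<and> (0::real ^ 'd) $ i < (b $ i - a $ i) / 2 ^ n"
    using ab by simp
  show ?thesis
    using assms(2,3) cell_corner_offset[OF ab 0, of x]
    unfolding grid_constant_dyadic_level_iff[OF ab] add_0_right by (metis (no_types))
qed

lemma borel_measurable_cell_corner: "cell_corner a b n \<in> borel_measurable borel"
  for a b :: "real ^ 'd"
proof -
  have "(\<lambda>x. cell_corner a b n x $ i) \<in> borel_measurable borel" for i
    unfolding cell_corner_def dyadic_node_def cell_index_def by simp measurable
  then show ?thesis
    by (subst borel_measurable_euclidean_space) (auto simp: Basis_vec_def cart_eq_inner_axis)
qed

text \<open>On the box \<open>f\<close> agrees with its composition with \<open>cell_corner\<close>,
  and composing any function with a simple function is again simple.\<close>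

lemma grid_constant_measurable:
  fixes a b :: "real ^ 'd"
  assumes ab: "\<forall>i. a $ i < b $ i" and f: "grid_constant a b (dyadic_level a b n) f"
  shows "f \<in> borel_measurable (lebesgue_on (cbox a b))"
proof -
  have "simple_function (borel :: (real ^ 'd) measure) (cell_corner a b n)"
    using borel_measurable_cell_corner finite_range_cell_corner by (intro simple_function_borel_measurable) auto
  then have "f \<circ> cell_corner a b n \<in> borel_measurable borel"
    by (intro borel_measurable_simple_function simple_function_compose)
  then have "f \<circ> cell_corner a b n \<in> borel_measurable (lebesgue_on (cbox a b))"
    by (simp add: borel_measurable_if_I measurable_completion measurable_restrict_space1)
  then show ?thesis
    using grid_constant_cell_corner[OF ab f] by (subst measurable_cong) auto
qed

lemma grid_constant_bounded:
  assumes ab: "\<forall>i. a $ i < b $ i" and f: "grid_constant a b (dyadic_level a b n) f"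
  shows "\<exists>B. \<forall>x\<in>cbox a b. \<bar>f x\<bar> \<le> B"
proof -
  have "finite ((\<lambda>x. \<bar>f x\<bar>) ` range (cell_corner a b n))"
    using finite_range_cell_corner by blast
  then have bound: "\<bar>f (cell_corner a b n x)\<bar> \<le> Max ((\<lambda>x. \<bar>f x\<bar>) ` range (cell_corner a b n))" for x
    by (intro Max_ge) auto
  show ?thesis
  proof (intro exI ballI)
    fix x assume "x \<in> cbox a b"
    then have "f x = f (cell_corner a b n x)"
      by (rule grid_constant_cell_corner[OF ab f])
    then show "\<bar>f x\<bar> \<le> Max ((\<lambda>x. \<bar>f x\<bar>) ` range (cell_corner a b n))"
      using bound[of x] by simp
  qed
qed

text \<open>Sampling \<open>f\<close> once in every cell, always at the same offset \<open>u\<close> from the corner, preserves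
  monotonicity. Almost every \<open>u\<close> avoids the exceptional null set in all of the finitely many cells.\<close>

lemma sigma_monotonic_grid_approximation:
  fixes a b :: "real ^ 'd" and \<sigma> :: "int ^ 'd"
  assumes ab: "\<forall>i. a $ i < b $ i" and f: "sigma_monotonic_on \<sigma> (cbox a b) f"
    and g: "grid_constant a b (dyadic_level a b n) g"
    and N: "N \<in> null_sets lebesgue" "\<And>x. x \<in> cbox a b - N \<Longrightarrow> \<bar>g x - f x\<bar> \<le> e"
  shows "\<exists>h. grid_constant a b (dyadic_level a b n) h \<and> sigma_monotonic_on \<sigma> (cbox a b) h \<and>
    (\<forall>x\<in>cbox a b. \<bar>g x - h x\<bar> \<le> e)"
proof -
  let ?c = "cell_corner a b n"
  define s :: "real ^ 'd" where "s = (\<chi> i. (b $ i - a $ i) / 2 ^ n)"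
  \<comment> \<open>Translating \<open>N\<close> by minus a corner gives the offsets that lead from
    this corner into \<open>N\<close>. Finitely many such translates cannot cover
    \<open>box 0 s\<close>, which has positive measure.\<close>
  define Bad where "Bad = (\<Union>v\<in>range ?c. (+) (- v) ` N)"
  have "negligible Bad"
    unfolding Bad_def
  proof (rule negligible_Union)
    show "finite ((\<lambda>v. (+) (- v) ` N) ` range ?c)"
      using finite_range_cell_corner by blast
    have "negligible ((+) v ` N)" for v
      using N(1) by (intro negligible_translation) (simp add: negligible_iff_null_sets)
    then show "negligible t" if "t \<in> (\<lambda>v. (+) (- v) ` N) ` range ?c" for t
      using that by blast
  qed
  moreover have "\<not> negligible (box 0 s)"
    using ab by (simp add: negligible_interval interval_ne_empty_cart s_def)
  ultimately obtain u where u: "u \<in> box 0 s" "u \<notin> Bad"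
    using negligible_subset by blast
  have u': "\<forall>i. 0 \<le> u $ i \<and> u $ i < (b $ i - a $ i) / 2 ^ n"
    using u(1) by (auto simp: mem_box_cart s_def less_imp_le)
  note corner = cell_corner_offset[OF ab u']
  have notN: "?c x + u \<notin> N" for x
  proof
    assume "?c x + u \<in> N"
    then have "- ?c x + (?c x + u) \<in> Bad"
      unfolding Bad_def by blast
    then show False
      using u(2) by simp
  qed
  define h where "h = (\<lambda>x. f (?c x + u))"
  have "grid_constant a b (dyadic_level a b n) h"
    unfolding grid_constant_dyadic_level_iff[OF ab] by (simp add: h_def cell_corner_def)
  moreover have "sigma_monotonic_on \<sigma> (cbox a b) h"
  proof (rule monotone_onI)
    fix x y assume "sigma_le \<sigma> x y"
    then have "sigma_le \<sigma> (?c x + u) (?c y + u)"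
      unfolding sigma_le_def
    proof (intro allI conjI impI)
      fix i
      let ?s = "real_of_int (\<sigma> $ i)"
      \<comment> \<open>Each corner coordinate is a nondecreasing function of the same coordinate of
        the point. This settles both signs of \<open>\<sigma> $ i\<close>, and used in both
        directions it gives the equality required for \<open>\<sigma> $ i\<close> = 0.\<close>
      have le: "(?c p + u) $ i \<le> (?c q + u) $ i" if "p $ i \<le> q $ i" for p q
      proof -
        have "real (cell_index a b n p i) * ((b $ i - a $ i) / 2 ^ n)
            \<le> real (cell_index a b n q i) * ((b $ i - a $ i) / 2 ^ n)"
          using ab[rule_format, of i] cell_index_mono[of a i b p q n] that
          by (intro mult_right_mono) auto
        then show ?thesis
          by (simp add: cell_corner_def dyadic_node_def)
      qed
      {
        assume "\<sigma> $ i = 0"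
        then have "x $ i = y $ i"
          using \<open>sigma_le \<sigma> x y\<close> by (simp add: sigma_le_def)
        then show "(?c x + u) $ i = (?c y + u) $ i"
          using le[of x y] le[of y x] by simp
      }
      {
        assume "\<sigma> $ i \<noteq> 0"
        then have "?s \<noteq> 0" "?s * x $ i \<le> ?s * y $ i"
          using \<open>sigma_le \<sigma> x y\<close> by (auto simp: sigma_le_def)
        then show "?s * (?c x + u) $ i \<le> ?s * (?c y + u) $ i"
          using le[of x y] le[of y x] by (auto simp: mult_le_cancel_left simp del: of_int_less_0_iff of_int_0_less_iff)
      }
    qed
    then show "h x \<le> h y"
      unfolding h_def using f corner(1) by (auto dest: monotone_onD)
  qed
  moreover have "\<bar>g x - h x\<bar> \<le> e" if "x \<in> cbox a b" for x
  proof -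
    \<comment> \<open>\<open>g\<close> does not change within the cell, so the comparison can be
      made at the sampling point, where the estimate outside \<open>N\<close> is available.\<close>
    have "g x = g (?c x + u)"
      using g that corner unfolding grid_constant_dyadic_level_iff[OF ab] by metis
    then show ?thesis
      using N(2)[of "?c x + u"] corner(1) notN by (simp add: h_def)
  qed
  ultimately show ?thesis
    by blast
qed


section \<open>The projection onto monotone functions in the supremum norm\<close>

lemma AE_lebesgue_onE:
  assumes "Q \<in> sets lebesgue" "AE x in lebesgue_on Q. P x"
  obtains N where "N \<in> null_sets lebesgue" "\<And>x. x \<in> Q - N \<Longrightarrow> P x"
proof -
  have "AE x in lebesgue. x \<in> Q \<longrightarrow> P x"
    using assms by (subst (asm) AE_restrict_space_iff) auto
  then obtain N where "{x \<in> space lebesgue. \<not> (x \<in> Q \<longrightarrow> P x)} \<subseteq> N" "emeasure lebesgue N = 0" "N \<in> sets lebesgue"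
    by (rule AE_E)
  then show ?thesis
    by (intro that[of N]) auto
qed

text \<open>The function can serve as its own representative once the null set where it differs from
  \<open>f0\<close> is added to the exceptional set.\<close>

lemma L2_sigma_iff:
  assumes Q: "Q \<in> sets lebesgue"
  shows "f \<in> L2_sigma \<sigma> Q \<longleftrightarrow>
    f \<in> square_integrable (lebesgue_on Q) \<and> (\<exists>N\<in>null_sets lebesgue. sigma_monotonic_on \<sigma> (Q - N) f)"
proof (intro iffI conjI)
  assume f: "f \<in> L2_sigma \<sigma> Q"
  then show "f \<in> square_integrable (lebesgue_on Q)"
    by (simp add: L2_sigma_def L2_space_def square_integrable_def)
  obtain f0 N where f0: "ae_eq_on Q f0 f" and N: "N \<in> null_sets lebesgue" "sigma_monotonic_on \<sigma> (Q - N) f0"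
    using f by (auto simp: L2_sigma_def)
  obtain N' where N': "N' \<in> null_sets lebesgue" "\<And>x. x \<in> Q - N' \<Longrightarrow> f0 x = f x"
    using AE_lebesgue_onE[OF Q f0[unfolded ae_eq_on_def]] by blast
  have "sigma_monotonic_on \<sigma> (Q - (N \<union> N')) f"
  proof (rule monotone_onI)
    fix x y assume "x \<in> Q - (N \<union> N')" "y \<in> Q - (N \<union> N')" "sigma_le \<sigma> x y"
    then show "f x \<le> f y"
      using monotone_onD[OF N(2), of x y] N'(2)[of x] N'(2)[of y] by simp
  qed
  then show "\<exists>N\<in>null_sets lebesgue. sigma_monotonic_on \<sigma> (Q - N) f"
    using N(1) N'(1) by blast
next
  assume "f \<in> square_integrable (lebesgue_on Q) \<and> (\<exists>N\<in>null_sets lebesgue. sigma_monotonic_on \<sigma> (Q - N) f)"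
  then show "f \<in> L2_sigma \<sigma> Q"
    by (auto simp: L2_sigma_def L2_space_def square_integrable_def ae_eq_on_def)
qed

text \<open>Sum, nonnegative multiple, \<open>min\<close> and \<open>max\<close> are all
  nondecreasing in their arguments, so \<open>lift2\<close> treats them alike. For limits, the
  countable union of the exceptional sets is still null, and inequalities pass to the limit
  pointwise.\<close>

lemma isotonic_cone_L2_sigma:
  assumes Q: "Q \<in> lmeasurable"
  shows "isotonic_cone (lebesgue_on Q) (L2_sigma \<sigma> Q)"
proof -
  have Q': "Q \<in> sets lebesgue"
    using Q by blast
  interpret finite_measure "lebesgue_on Q"
    using Q by (rule finite_measure_lebesgue_on)
  note iff = L2_sigma_iff[OF Q', of _ \<sigma>]
  have lift2: "(\<lambda>x. F (g x) (h x)) \<in> L2_sigma \<sigma> Q"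
    if g: "g \<in> L2_sigma \<sigma> Q" and h: "h \<in> L2_sigma \<sigma> Q"
      and F: "\<And>s s' t t'. s \<le> s' \<Longrightarrow> t \<le> t' \<Longrightarrow> F s t \<le> F s' t'"
      and sq: "(\<lambda>x. F (g x) (h x)) \<in> square_integrable (lebesgue_on Q)" for g h F
  proof -
    obtain N N' where "N \<in> null_sets lebesgue" "N' \<in> null_sets lebesgue"
      "sigma_monotonic_on \<sigma> (Q - N) g" "sigma_monotonic_on \<sigma> (Q - N') h"
      using g h unfolding iff by blast
    then have "sigma_monotonic_on \<sigma> (Q - (N \<union> N')) (\<lambda>x. F (g x) (h x))" "N \<union> N' \<in> null_sets lebesgue"
      using F by (auto simp: monotone_on_def)
    then show ?thesis
      using sq unfolding iff by blast
  qed
  have minmax: "(\<lambda>x. F (g x) (h x)) \<in> square_integrable (lebesgue_on Q)"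
    if gh: "g \<in> square_integrable (lebesgue_on Q)" "h \<in> square_integrable (lebesgue_on Q)"
      and F: "F = min \<or> F = max" for g h and F :: "real \<Rightarrow> real \<Rightarrow> real"
  proof (rule square_integrableI_bound)
    show "(\<lambda>x. F (g x) (h x)) \<in> borel_measurable (lebesgue_on Q)"
      using gh F by (auto simp: square_integrable_def)
    show "integrable (lebesgue_on Q) (\<lambda>x. (g x)\<^sup>2 + (h x)\<^sup>2)"
      using gh by (auto simp: square_integrable_def)
    show "AE x in lebesgue_on Q. (F (g x) (h x))\<^sup>2 \<le> (g x)\<^sup>2 + (h x)\<^sup>2"
      using F by (auto simp: min_def max_def)
  qed
  show ?thesis
  proof unfold_locales
    show "g \<in> square_integrable (lebesgue_on Q)" if "g \<in> L2_sigma \<sigma> Q" for g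
      using that by (simp add: iff)
    show "(\<lambda>_. c) \<in> L2_sigma \<sigma> Q" for c
      by (auto simp: iff square_integrable_def monotone_on_def intro: bexI[of _ "{}"])
    show "(\<lambda>x. g x + h x) \<in> L2_sigma \<sigma> Q" if "g \<in> L2_sigma \<sigma> Q" "h \<in> L2_sigma \<sigma> Q" for g h
      using that by (intro lift2[where F = "(+)"]) (auto simp: iff intro: square_integrable_add)
    show "(\<lambda>x. c * g x) \<in> L2_sigma \<sigma> Q" if "0 \<le> c" "g \<in> L2_sigma \<sigma> Q" for c g
      using that by (intro lift2[where F = "\<lambda>s t. c * s" and h = g])
        (auto simp: iff intro: square_integrable_scale mult_left_mono)
    show "(\<lambda>x. min (g x) (h x)) \<in> L2_sigma \<sigma> Q" if "g \<in> L2_sigma \<sigma> Q" "h \<in> L2_sigma \<sigma> Q" for g h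
      using that by (intro lift2[where F = min]) (auto simp: iff intro!: min.mono minmax[where F = min])
    show "(\<lambda>x. max (g x) (h x)) \<in> L2_sigma \<sigma> Q" if "g \<in> L2_sigma \<sigma> Q" "h \<in> L2_sigma \<sigma> Q" for g h
      using that by (intro lift2[where F = max]) (auto simp: iff intro!: max.mono minmax[where F = max])
    show "g \<in> L2_sigma \<sigma> Q" if s: "\<And>n. s n \<in> L2_sigma \<sigma> Q"
      and lim: "AE x in lebesgue_on Q. (\<lambda>n. s n x) \<longlonglongrightarrow> g x"
      and g: "g \<in> square_integrable (lebesgue_on Q)" for s :: "nat \<Rightarrow> _ \<Rightarrow> real" and g
    proof -
      have "\<forall>n. \<exists>N\<in>null_sets lebesgue. sigma_monotonic_on \<sigma> (Q - N) (s n)"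
        using s unfolding iff by blast
      then obtain N where N: "\<And>n. N n \<in> null_sets lebesgue" "\<And>n. sigma_monotonic_on \<sigma> (Q - N n) (s n)"
        by metis
      obtain N' where N': "N' \<in> null_sets lebesgue" "\<And>x. x \<in> Q - N' \<Longrightarrow> (\<lambda>n. s n x) \<longlonglongrightarrow> g x"
        using AE_lebesgue_onE[OF Q' lim] by blast
      have "sigma_monotonic_on \<sigma> (Q - (N' \<union> (\<Union>n. N n))) g"
      proof (rule monotone_onI)
        fix x y assume xy: "x \<in> Q - (N' \<union> (\<Union>n. N n))" "y \<in> Q - (N' \<union> (\<Union>n. N n))" "sigma_le \<sigma> x y"
        have "s n x \<le> s n y" for n
          using xy by (intro monotone_onD[OF N(2)[of n]]) auto
        then show "g x \<le> g y"
          using xy by (intro LIMSEQ_le[OF N'(2) N'(2)]) auto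
      qed
      moreover have "N' \<union> (\<Union>n. N n) \<in> null_sets lebesgue"
        using N(1) N'(1) by auto
      ultimately show ?thesis
        using g unfolding iff by blast
    qed
  qed
qed

text \<open>Existence of some minimizer guarantees that the choice made by \<open>arg_min\<close> is
  one.\<close>

lemma is_proj_proj_sigma:
  assumes Q: "Q \<in> lmeasurable" and f: "f \<in> square_integrable (lebesgue_on Q)"
    and w: "weight_on (lebesgue_on Q) w"
  shows "isotonic_cone.is_proj (lebesgue_on Q) (L2_sigma \<sigma> Q) w f (proj_sigma \<sigma> Q w f)"
proof -
  interpret isotonic_cone "lebesgue_on Q" "L2_sigma \<sigma> Q"
    using Q by (rule isotonic_cone_L2_sigma)
  obtain g where g: "is_proj w f g"
    using is_proj_exists[OF f w] by blast
  let ?J = "weighted_error (lebesgue_on Q) w f"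
  have "is_arg_min ?J (\<lambda>g. g \<in> L2_sigma \<sigma> Q) g"
    using g unfolding is_arg_min_def is_proj_def by (meson not_less)
  moreover have "proj_sigma \<sigma> Q w f = arg_min ?J (\<lambda>g. g \<in> L2_sigma \<sigma> Q)"
    by (simp add: proj_sigma_def arg_min_on_def weighted_error_def[abs_def])
  ultimately have "is_arg_min ?J (\<lambda>g. g \<in> L2_sigma \<sigma> Q) (proj_sigma \<sigma> Q w f)"
    unfolding arg_min_def by (metis someI)
  then show ?thesis
    unfolding is_arg_min_def is_proj_def by (meson not_less)
qed

section \<open>Estimates in the essential supremum norm\<close>

lemma Linf_norm_leI:
  assumes "u \<in> borel_measurable (lebesgue_on Q)" "AE x in lebesgue_on Q. \<bar>u x\<bar> \<le> d"
  shows "Linf_norm Q u \<le> ereal d"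
  unfolding Linf_norm_def using assms by (intro esssup_I) auto

lemma Linf_norm_leD:
  assumes "Linf_norm Q u \<le> ereal d"
  shows "AE x in lebesgue_on Q. \<bar>u x\<bar> \<le> d"
  using esssup_AE[of "\<lambda>x. ereal \<bar>u x\<bar>" "lebesgue_on Q"]
proof eventually_elim
  case (elim x)
  also have "esssup (lebesgue_on Q) (\<lambda>x. ereal \<bar>u x\<bar>) \<le> ereal d"
    using assms by (simp add: Linf_norm_def)
  finally show ?case
    by simp
qed

text \<open>Over a null set the essential supremum of a measurable function would be minus
  infinity.\<close>

lemma Linf_norm_nonneg:
  assumes "emeasure (lebesgue_on Q) Q \<noteq> 0"
  shows "0 \<le> Linf_norm Q u"
proof -
  have "esssup (lebesgue_on Q) (\<lambda>_. 0 :: ereal) = 0"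
    using assms by (intro esssup_const) simp
  moreover have "esssup (lebesgue_on Q) (\<lambda>_. 0 :: ereal) \<le> Linf_norm Q u"
    unfolding Linf_norm_def by (intro esssup_mono) auto
  ultimately show ?thesis
    by simp
qed

lemma Linf_spaceE:
  assumes "f \<in> Linf_space Q"
  obtains B where "AE x in lebesgue_on Q. \<bar>f x\<bar> \<le> B"
proof -
  have "Linf_norm Q f < \<infinity>"
    using assms by (simp add: Linf_space_def)
  then obtain B where "Linf_norm Q f \<le> ereal B"
    by (metis ereal_infty_less(1) less_PInf_Ex_of_nat less_imp_le)
  then show ?thesis
    using that Linf_norm_leD by blast
qed

lemma bounded_square_integrable:
  assumes "Q \<in> lmeasurable" "f \<in> borel_measurable (lebesgue_on Q)" "AE x in lebesgue_on Q. \<bar>f x\<bar> \<le> B"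
  shows "f \<in> square_integrable (lebesgue_on Q)"
proof (rule square_integrableI_bound)
  interpret finite_measure "lebesgue_on Q"
    using assms(1) by (rule finite_measure_lebesgue_on)
  show "integrable (lebesgue_on Q) (\<lambda>_. B\<^sup>2)"
    by simp
  show "AE x in lebesgue_on Q. (f x)\<^sup>2 \<le> B\<^sup>2"
    using assms(3) by eventually_elim (simp add: abs_le_square_iff[symmetric])
qed (rule assms)

lemma proj_sigma_measurable:
  assumes "Q \<in> lmeasurable" "f \<in> square_integrable (lebesgue_on Q)" "weight_on (lebesgue_on Q) w"
  shows "proj_sigma \<sigma> Q w f \<in> borel_measurable (lebesgue_on Q)"
proof -
  interpret isotonic_cone "lebesgue_on Q" "L2_sigma \<sigma> Q"
    using assms(1) by (rule isotonic_cone_L2_sigma)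
  show ?thesis
    using is_proj_proj_sigma[OF assms, of \<sigma>] K_square_integrable by (auto simp: is_proj_def square_integrable_def)
qed

lemma proj_sigma_contraction:
  assumes Q: "Q \<in> lmeasurable" and w: "weight_on (lebesgue_on Q) w"
    and f: "f \<in> square_integrable (lebesgue_on Q)" and g: "g \<in> square_integrable (lebesgue_on Q)"
    and nonneg: "0 \<le> Linf_norm Q (\<lambda>x. g x - f x)"
  shows "Linf_norm Q (\<lambda>x. proj_sigma \<sigma> Q w g x - proj_sigma \<sigma> Q w f x) \<le> Linf_norm Q (\<lambda>x. g x - f x)"
proof (cases "Linf_norm Q (\<lambda>x. g x - f x)")
  case (real d)
  interpret isotonic_cone "lebesgue_on Q" "L2_sigma \<sigma> Q"
    using Q by (rule isotonic_cone_L2_sigma)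
  have "AE x in lebesgue_on Q. \<bar>g x - f x\<bar> \<le> d"
    using real by (intro Linf_norm_leD) simp
  then have "AE x in lebesgue_on Q. \<bar>proj_sigma \<sigma> Q w g x - proj_sigma \<sigma> Q w f x\<bar> \<le> d"
    using is_proj_contraction[OF is_proj_proj_sigma is_proj_proj_sigma f g w] Q f g w by blast
  then show ?thesis
    unfolding real using proj_sigma_measurable[OF Q _ w] f g by (intro Linf_norm_leI) auto
qed (use nonneg in auto)

text \<open>Triangle inequality through the projection of \<open>f\<close> with weight
  \<open>w'\<close>: the function changes under a fixed weight, and the weight under a fixed
  function.\<close>

lemma proj_sigma_perturbation:
  assumes Q: "Q \<in> lmeasurable" and w: "weight_on (lebesgue_on Q) w" and w': "weight_on (lebesgue_on Q) w'"
    and f: "f \<in> square_integrable (lebesgue_on Q)" and f': "f' \<in> square_integrable (lebesgue_on Q)"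
    and B: "AE x in lebesgue_on Q. \<bar>f x\<bar> \<le> B"
    and c: "c > 0" "AE x in lebesgue_on Q. c \<le> w' x"
    and ef: "AE x in lebesgue_on Q. \<bar>f' x - f x\<bar> \<le> e"
    and ew: "AE x in lebesgue_on Q. \<bar>w' x - w x\<bar> \<le> e"
  shows "Linf_norm Q (\<lambda>x. proj_sigma \<sigma> Q w' f' x - proj_sigma \<sigma> Q w f x) \<le> ereal (e * (1 + 2 * B / c))"
proof -
  interpret isotonic_cone "lebesgue_on Q" "L2_sigma \<sigma> Q"
    using Q by (rule isotonic_cone_L2_sigma)
  note proj = is_proj_proj_sigma[OF Q]
  have "AE x in lebesgue_on Q. \<bar>proj_sigma \<sigma> Q w' f' x - proj_sigma \<sigma> Q w' f x\<bar> \<le> e"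
    by (rule is_proj_contraction[OF proj[OF f w'] proj[OF f' w'] f f' w' ef])
  moreover have "AE x in lebesgue_on Q. \<bar>proj_sigma \<sigma> Q w' f x - proj_sigma \<sigma> Q w f x\<bar> \<le> 2 * B * (e / c)"
    by (rule is_proj_weight_perturbation[OF proj[OF f w] proj[OF f w'] f w w' B c ew])
  ultimately have "AE x in lebesgue_on Q. \<bar>proj_sigma \<sigma> Q w' f' x - proj_sigma \<sigma> Q w f x\<bar> \<le> e * (1 + 2 * B / c)"
    by eventually_elim (simp add: algebra_simps)
  then show ?thesis
    using proj_sigma_measurable[OF Q f' w'] proj_sigma_measurable[OF Q f w]
    by (intro Linf_norm_leI) auto
qed

section \<open>Step functions, density and the convergence theorem\<close>

lemma S_setE:
  assumes ab: "\<forall>i. a $ i < b $ i" and "f \<in> S_set a b I"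
  obtains n where "grid_constant a b (dyadic_level a b n) f" "\<And>x. x \<in> cbox a b \<Longrightarrow> f x \<in> I"
proof -
  obtain G where G: "dyadic_grid a b G" "grid_constant a b G f"
    using assms(2) by (auto simp: S_set_def dyadically_grid_constant_def)
  obtain n where "G = dyadic_level a b n"
    using G(1) unfolding dyadic_grid_iff[OF ab] ..
  with G(2) have "grid_constant a b (dyadic_level a b n) f"
    by simp
  moreover have "f x \<in> I" if "x \<in> cbox a b" for x
    using assms(2) that by (auto simp: S_set_def)
  ultimately show ?thesis
    by (rule that)
qed

lemma grid_constant_weight:
  assumes ab: "\<forall>i. a $ i < b $ i" and w: "grid_constant a b (dyadic_level a b n) w"
    and c: "c > 0" "\<And>x. x \<in> cbox a b \<Longrightarrow> c \<le> w x"
  shows "weight_on (lebesgue_on (cbox a b)) w"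
proof -
  obtain B where "\<And>x. x \<in> cbox a b \<Longrightarrow> \<bar>w x\<bar> \<le> B"
    using grid_constant_bounded[OF ab w] by blast
  then have "AE x in lebesgue_on (cbox a b). c \<le> w x \<and> w x \<le> B"
    using c(2) by (intro AE_I2) (auto dest: abs_le_D1)
  then show ?thesis
    unfolding weight_on_def using grid_constant_measurable[OF ab w] c(1) by blast
qed

lemma S_sigma_subset_S_inf_sigma:
  fixes a b :: "real ^ 'd"
  assumes ab: "\<forall>i. a $ i < b $ i"
  shows "S_sigma \<sigma> a b UNIV \<subseteq> S_inf_sigma \<sigma> a b"
proof
  fix f assume f: "f \<in> S_sigma \<sigma> a b UNIV"
  then have fS: "f \<in> S_set a b UNIV" and mono: "sigma_monotonic_on \<sigma> (cbox a b) f"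
    by (auto simp: S_sigma_def)
  obtain n where n: "grid_constant a b (dyadic_level a b n) f"
    using S_setE[OF ab fS] by blast
  have meas: "f \<in> borel_measurable (lebesgue_on (cbox a b))"
    using grid_constant_measurable[OF ab n] .
  obtain B where "\<And>x. x \<in> cbox a b \<Longrightarrow> \<bar>f x\<bar> \<le> B"
    using grid_constant_bounded[OF ab n] by blast
  then have "Linf_norm (cbox a b) f \<le> ereal B"
    using meas by (intro Linf_norm_leI AE_I2) auto
  then have "f \<in> Linf_space (cbox a b)"
    using meas by (auto simp: Linf_space_def)
  moreover have "Linf_norm (cbox a b) (\<lambda>x. f x - f x) < ereal e" if "e > 0" for e
    using Linf_norm_leI[of "\<lambda>x. f x - f x" "cbox a b" 0] that by (simp add: order_le_less_trans)
  ultimately have "f \<in> S_inf a b"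
    unfolding S_inf_def Linf_closure_def using fS by blast
  then show "f \<in> S_inf_sigma \<sigma> a b"
    using mono unfolding S_inf_sigma_def ae_eq_on_def by auto
qed

text \<open>A step function near \<open>f\<close> need not be monotone. It only provides a grid on
  whose cells the monotone representative \<open>f0\<close> varies little, so that sampling
  \<open>f0\<close> there costs one more error of the same size.\<close>

lemma S_inf_sigma_subset_closure:
  fixes a b :: "real ^ 'd"
  assumes ab: "\<forall>i. a $ i < b $ i"
  shows "S_inf_sigma \<sigma> a b \<subseteq> Linf_closure (cbox a b) (S_sigma \<sigma> a b UNIV)"
proof
  let ?Q = "cbox a b"
  fix f assume "f \<in> S_inf_sigma \<sigma> a b"
  then obtain f0 where f: "f \<in> S_inf a b" and f0: "ae_eq_on ?Q f0 f" "sigma_monotonic_on \<sigma> ?Q f0"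
    unfolding S_inf_sigma_def by blast
  have fL: "f \<in> Linf_space ?Q"
    using f by (simp add: S_inf_def Linf_closure_def)
  have "\<exists>h\<in>S_sigma \<sigma> a b UNIV. Linf_norm ?Q (\<lambda>x. h x - f x) < ereal \<epsilon>" if \<epsilon>: "\<epsilon> > 0" for \<epsilon>
  proof -
    \<comment> \<open>One \<open>e\<close> for passing from \<open>f\<close> to \<open>g\<close>,
      one for passing from \<open>g\<close> to \<open>h\<close>; the third makes the inequality
      strict.\<close>
    define e where "e = \<epsilon> / 3"
    have e: "e > 0"
      using \<epsilon> by (simp add: e_def)
    obtain g where g: "g \<in> S_set a b UNIV" and norm: "Linf_norm ?Q (\<lambda>x. g x - f x) < ereal e"
      using f e unfolding S_inf_def Linf_closure_def by blast
    obtain n where n: "grid_constant a b (dyadic_level a b n) g"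
      using S_setE[OF ab g] by blast
    have gf: "AE x in lebesgue_on ?Q. \<bar>g x - f x\<bar> \<le> e"
      using norm by (intro Linf_norm_leD) simp
    then have "AE x in lebesgue_on ?Q. \<bar>g x - f0 x\<bar> \<le> e"
      using f0(1) unfolding ae_eq_on_def by eventually_elim simp
    then obtain N where "N \<in> null_sets lebesgue" "\<And>x. x \<in> ?Q - N \<Longrightarrow> \<bar>g x - f0 x\<bar> \<le> e"
      using AE_lebesgue_onE[of ?Q] by auto
    from sigma_monotonic_grid_approximation[OF ab f0(2) n this] obtain h where
      h: "grid_constant a b (dyadic_level a b n) h" "sigma_monotonic_on \<sigma> ?Q h" "\<forall>x\<in>?Q. \<bar>g x - h x\<bar> \<le> e"
      by blast
    have "dyadic_grid a b (dyadic_level a b n)"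
      using dyadic_grid_iff[OF ab] by blast
    then have "h \<in> S_sigma \<sigma> a b UNIV"
      using h(1,2) unfolding S_sigma_def S_set_def dyadically_grid_constant_def by blast
    moreover have "Linf_norm ?Q (\<lambda>x. h x - f x) \<le> ereal (2 * e)"
    proof (rule Linf_norm_leI)
      show "(\<lambda>x. h x - f x) \<in> borel_measurable (lebesgue_on ?Q)"
        using grid_constant_measurable[OF ab h(1)] fL by (auto simp: Linf_space_def)
      have "AE x in lebesgue_on ?Q. \<bar>g x - h x\<bar> \<le> e"
        using h(3) by (intro AE_I2) simp
      with gf show "AE x in lebesgue_on ?Q. \<bar>h x - f x\<bar> \<le> 2 * e"
        by eventually_elim simp
    qed
    moreover have "ereal (2 * e) < ereal \<epsilon>"
      using \<epsilon> by (simp add: e_def)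
    ultimately show ?thesis
      using order_le_less_trans by blast
  qed
  with fL show "f \<in> Linf_closure ?Q (S_sigma \<sigma> a b UNIV)"
    by (simp add: Linf_closure_def)
qed

lemma S_inf_pos_weight:
  assumes ab: "\<forall>i. a $ i < b $ i" and w: "w \<in> S_inf_pos a b"
  shows "weight_on (lebesgue_on (cbox a b)) w"
proof -
  obtain c where c: "c > 0" "w \<in> Linf_closure (cbox a b) (S_set a b {c..})"
    using w by (auto simp: S_inf_pos_def)
  have wL: "w \<in> Linf_space (cbox a b)"
    using c(2) by (simp add: Linf_closure_def)
  \<comment> \<open>A single approximant with values at least \<open>c\<close> and distance below c
    / 2 already yields the lower bound c / 2 for \<open>w\<close>.\<close>
  obtain h where h: "h \<in> S_set a b {c..}" "Linf_norm (cbox a b) (\<lambda>x. h x - w x) < ereal (c / 2)"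
    using c half_gt_zero[OF c(1)] unfolding Linf_closure_def by blast
  have "AE x in lebesgue_on (cbox a b). c \<le> h x"
    using h(1) by (intro AE_I2) (auto simp: S_set_def)
  moreover have "AE x in lebesgue_on (cbox a b). \<bar>h x - w x\<bar> \<le> c / 2"
    using h(2) by (intro Linf_norm_leD) simp
  moreover obtain B where "AE x in lebesgue_on (cbox a b). \<bar>w x\<bar> \<le> B"
    using Linf_spaceE[OF wL] by blast
  ultimately have "AE x in lebesgue_on (cbox a b). c / 2 \<le> w x \<and> w x \<le> B"
  proof eventually_elim
    case (elim x)
    then show ?case
      unfolding abs_le_iff by (intro conjI) linarith+
  qed
  moreover have "w \<in> borel_measurable (lebesgue_on (cbox a b))" "c / 2 > 0"
    using wL c(1) by (simp_all add: Linf_space_def)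
  ultimately show ?thesis
    unfolding weight_on_def by blast
qed

lemma tendsto_0_ereal_bound:
  assumes "\<And>n. 0 \<le> u n" "\<And>n. u n \<le> ereal (r n)" "r \<longlonglongrightarrow> 0"
  shows "u \<longlonglongrightarrow> 0"
proof (rule tendsto_sandwich[of "\<lambda>_. 0" _ _ "\<lambda>n. ereal (r n)"])
  show "(\<lambda>n. ereal (r n)) \<longlonglongrightarrow> 0"
    using tendsto_ereal[OF assms(3)] by (simp add: zero_ereal_def)
qed (use assms in auto)

theorem theorem4p7:
  fixes a b :: "real ^ 'd" and \<sigma> :: "int ^ 'd"
  assumes "\<forall>i. a $ i < b $ i"
    and "\<forall>i. \<sigma> $ i \<in> {-1, 0, 1}"
  shows
    "(\<forall>f \<in> S_inf a b. \<forall>w \<in> S_inf_pos a b.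
        \<exists>(G :: nat \<Rightarrow> (real ^ 'd) set) (fn :: nat \<Rightarrow> real ^ 'd \<Rightarrow> real) (wn :: nat \<Rightarrow> real ^ 'd \<Rightarrow> real).
          (\<forall>n. dyadic_grid a b (G n)) \<and>
          (\<forall>n. grid_constant a b (G n) (fn n)) \<and>
          (\<forall>n. grid_constant a b (G n) (wn n) \<and> (\<forall>x\<in>cbox a b. wn n x > 0)) \<and>
          (\<lambda>n. Linf_norm (cbox a b) (\<lambda>x. fn n x - f x)) \<longlonglongrightarrow> 0 \<and>
          (\<lambda>n. Linf_norm (cbox a b) (\<lambda>x. wn n x - w x)) \<longlonglongrightarrow> 0 \<and>
          (\<lambda>n. Linf_norm (cbox a b)
                 (\<lambda>x. proj_sigma \<sigma> (cbox a b) (wn n) (fn n) x - proj_sigma \<sigma> (cbox a b) w f x))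
            \<longlonglongrightarrow> 0 \<and>
          (dyadically_grid_constant_class a b w \<longrightarrow>
            (\<forall>n. Linf_norm (cbox a b)
                   (\<lambda>x. proj_sigma \<sigma> (cbox a b) w (fn n) x - proj_sigma \<sigma> (cbox a b) w f x)
                 \<le> Linf_norm (cbox a b) (\<lambda>x. fn n x - f x)))) \<and>
     S_sigma \<sigma> a b UNIV \<subseteq> S_inf_sigma \<sigma> a b \<and>
     S_inf_sigma \<sigma> a b \<subseteq> Linf_closure (cbox a b) (S_sigma \<sigma> a b UNIV)"
proof (intro conjI ballI)
  note ab = assms(1)
  show "S_sigma \<sigma> a b UNIV \<subseteq> S_inf_sigma \<sigma> a b"
    using ab by (rule S_sigma_subset_S_inf_sigma)
  show "S_inf_sigma \<sigma> a b \<subseteq> Linf_closure (cbox a b) (S_sigma \<sigma> a b UNIV)"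
    using ab by (rule S_inf_sigma_subset_closure)
  fix f w assume f: "f \<in> S_inf a b" and w: "w \<in> S_inf_pos a b"
  let ?Q = "cbox a b"
  let ?e = "\<lambda>n. 1 / real (Suc n)"
  have Q: "?Q \<in> lmeasurable"
    by simp
  have "\<not> negligible ?Q"
    using ab by (simp add: negligible_interval interval_ne_empty_cart)
  then have "emeasure (lebesgue_on ?Q) ?Q \<noteq> 0"
    by (auto simp: negligible_iff_null_sets null_sets_def emeasure_restrict_space)
  then have nonneg: "0 \<le> Linf_norm ?Q u" for u
    by (rule Linf_norm_nonneg)
  obtain c where c: "c > 0" and wc: "w \<in> Linf_closure ?Q (S_set a b {c..})"
    using w by (auto simp: S_inf_pos_def)
  have fL: "f \<in> Linf_space ?Q"
    using f by (simp add: S_inf_def Linf_closure_def)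
  obtain B where B: "AE x in lebesgue_on ?Q. \<bar>f x\<bar> \<le> B"
    using Linf_spaceE[OF fL] by blast
  have fsq: "f \<in> square_integrable (lebesgue_on ?Q)"
    using fL by (intro bounded_square_integrable[OF Q _ B]) (simp add: Linf_space_def)
  have wgt: "weight_on (lebesgue_on ?Q) w"
    using S_inf_pos_weight[OF ab w] .
  \<comment> \<open>Both approximants are chosen together because one grid has to carry them; the
    level \<open>max m m'\<close> refines both of their grids. The lower bound \<open>c\<close> does
    not depend on \<open>n\<close>, which keeps the perturbation constant uniform.\<close>
  define P where "P n m fn wn \<longleftrightarrow>
      grid_constant a b (dyadic_level a b m) fn \<and> grid_constant a b (dyadic_level a b m) wn \<and>
      (\<forall>x\<in>?Q. c \<le> wn x) \<and> Linf_norm ?Q (\<lambda>x. fn x - f x) \<le> ereal (?e n) \<and>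
      Linf_norm ?Q (\<lambda>x. wn x - w x) \<le> ereal (?e n)" for n m fn wn
  have "\<exists>m fn wn. P n m fn wn" for n
  proof -
    have e: "?e n > 0"
      by simp
    obtain fn where fn: "fn \<in> S_set a b UNIV" "Linf_norm ?Q (\<lambda>x. fn x - f x) < ereal (?e n)"
      using f e unfolding S_inf_def Linf_closure_def by blast
    obtain wn where wn: "wn \<in> S_set a b {c..}" "Linf_norm ?Q (\<lambda>x. wn x - w x) < ereal (?e n)"
      using wc e unfolding Linf_closure_def by blast
    obtain m where m: "grid_constant a b (dyadic_level a b m) fn"
      using S_setE[OF ab fn(1)] by blast
    obtain m' where m': "grid_constant a b (dyadic_level a b m') wn"
      using S_setE[OF ab wn(1)] by blast
    have "\<forall>x\<in>?Q. c \<le> wn x"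
      using wn(1) by (auto simp: S_set_def)
    then have "P n (max m m') fn wn"
      unfolding P_def using fn(2) wn(2)
      by (intro conjI grid_constant_refine[OF ab max.cobounded1 m]
          grid_constant_refine[OF ab max.cobounded2 m'] less_imp_le)
    then show ?thesis
      by blast
  qed
  then obtain m fn wn where P: "\<And>n. P n (m n) (fn n) (wn n)"
    by metis
  then have fn: "grid_constant a b (dyadic_level a b (m n)) (fn n)"
    and wn: "grid_constant a b (dyadic_level a b (m n)) (wn n)" "x \<in> ?Q \<Longrightarrow> c \<le> wn n x"
    and fnf: "Linf_norm ?Q (\<lambda>x. fn n x - f x) \<le> ereal (?e n)"
    and wnw: "Linf_norm ?Q (\<lambda>x. wn n x - w x) \<le> ereal (?e n)" for n x
    unfolding P_def by blast+
  have fnsq: "fn n \<in> square_integrable (lebesgue_on ?Q)" for n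
  proof -
    obtain B where "\<And>x. x \<in> ?Q \<Longrightarrow> \<bar>fn n x\<bar> \<le> B"
      using grid_constant_bounded[OF ab fn] by blast
    then show ?thesis
      by (intro bounded_square_integrable[OF Q grid_constant_measurable[OF ab fn], where B = B] AE_I2) simp
  qed
  have e0: "?e \<longlonglongrightarrow> 0"
    by (rule LIMSEQ_Suc[OF lim_1_over_n])
  have "(\<lambda>n. Linf_norm ?Q (\<lambda>x. fn n x - f x)) \<longlonglongrightarrow> 0" "(\<lambda>n. Linf_norm ?Q (\<lambda>x. wn n x - w x)) \<longlonglongrightarrow> 0"
    by (rule tendsto_0_ereal_bound[OF nonneg fnf e0], rule tendsto_0_ereal_bound[OF nonneg wnw e0])
  moreover have "(\<lambda>n. Linf_norm ?Q (\<lambda>x. proj_sigma \<sigma> ?Q (wn n) (fn n) x - proj_sigma \<sigma> ?Q w f x)) \<longlonglongrightarrow> 0"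
  proof (rule tendsto_0_ereal_bound[OF nonneg])
    show "Linf_norm ?Q (\<lambda>x. proj_sigma \<sigma> ?Q (wn n) (fn n) x - proj_sigma \<sigma> ?Q w f x)
        \<le> ereal (?e n * (1 + 2 * B / c))" for n
    proof (rule proj_sigma_perturbation[OF Q wgt _ fsq fnsq B c])
      show "weight_on (lebesgue_on ?Q) (wn n)"
        using grid_constant_weight[OF ab wn(1) c wn(2)] .
      show "AE x in lebesgue_on ?Q. c \<le> wn n x"
        using wn(2) by (intro AE_I2) simp
    qed (intro Linf_norm_leD fnf wnw)+
    show "(\<lambda>n. ?e n * (1 + 2 * B / c)) \<longlonglongrightarrow> 0"
      using tendsto_mult_right[OF e0, of "1 + 2 * B / c"] by simp
  qed
  \<comment> \<open>Both projections carry the weight \<open>w\<close>, so only the function changes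
    and the contraction gives the constant 1.\<close>
  moreover have "Linf_norm ?Q (\<lambda>x. proj_sigma \<sigma> ?Q w (fn n) x - proj_sigma \<sigma> ?Q w f x)
      \<le> Linf_norm ?Q (\<lambda>x. fn n x - f x)" for n
    by (rule proj_sigma_contraction[OF Q wgt fsq fnsq nonneg])
  moreover have "dyadic_grid a b (dyadic_level a b (m n))" for n
    using dyadic_grid_iff[OF ab] by blast
  moreover have "0 < wn n x" if "x \<in> ?Q" for n x
    using wn(2)[OF that, of n] c by linarith
  ultimately show "\<exists>(G :: nat \<Rightarrow> (real ^ 'd) set) (fn :: nat \<Rightarrow> real ^ 'd \<Rightarrow> real) (wn :: nat \<Rightarrow> real ^ 'd \<Rightarrow> real).
          (\<forall>n. dyadic_grid a b (G n)) \<and>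
          (\<forall>n. grid_constant a b (G n) (fn n)) \<and>
          (\<forall>n. grid_constant a b (G n) (wn n) \<and> (\<forall>x\<in>?Q. wn n x > 0)) \<and>
          (\<lambda>n. Linf_norm ?Q (\<lambda>x. fn n x - f x)) \<longlonglongrightarrow> 0 \<and>
          (\<lambda>n. Linf_norm ?Q (\<lambda>x. wn n x - w x)) \<longlonglongrightarrow> 0 \<and>
          (\<lambda>n. Linf_norm ?Q (\<lambda>x. proj_sigma \<sigma> ?Q (wn n) (fn n) x - proj_sigma \<sigma> ?Q w f x)) \<longlonglongrightarrow> 0 \<and>
          (dyadically_grid_constant_class a b w \<longrightarrow>
            (\<forall>n. Linf_norm ?Q (\<lambda>x. proj_sigma \<sigma> ?Q w (fn n) x - proj_sigma \<sigma> ?Q w f x)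
                 \<le> Linf_norm ?Q (\<lambda>x. fn n x - f x)))"
    using fn wn(1) by (intro exI[of _ "\<lambda>n. dyadic_level a b (m n)"] exI[of _ fn] exI[of _ wn]) simp
qed

end
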